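(* Let $k$ be an algebraically closed field of characteristic zero, let $V$ be a finite-dimensional $k$-vector space, and let $d_1,d_2$ be positive integers. Let $G=\mathrm{GL}(V)$ act naturally (diagonally) on $$W_{(d_1,d_2)}=\mathrm{Sym}^2(V)^{d_1}\oplus \mathrm{Sym}^2(V^* )^{d_2}.$$ After choosing a basis of $V$, identify an element of $W_{(d_1,d_2)}$ with a pair of tuples $(Q_1,\dots,Q_{d_1})$, $(R_1,\dots,R_{d_2})$ of symmetric matrices. Then the $k$-algebra of invariants $k[W_{(d_1,d_2)}]^{G}$ is generated by the polynomial functions $$\mathrm{Tr}(M_1M_2\cdots M_l),\qquad M_i=Q_{n_i}R_{m_i},$$ where $l\ge 1$, $n_i\in\{1,\dots,d_1\}$ and $m_i\in\{1,\dots,d_2\}$ for all $i$.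
   Context: $k[W]$ denotes the algebra of polynomial functions on a finite-dimensional vector space $W$. In matrix terms, with $N=\dim V$, $\mathrm{Sym}^2(V)$ and $\mathrm{Sym}^2(V^* )$ are identified with symmetric $N\times N$ matrices, and $g\in \mathrm{GL}_N(k)$ acts by $Q\mapsto gQg^t$ on $\mathrm{Sym}^2(V)$ and by $R\mapsto (g^{-1})^tRg^{-1}$ on $\mathrm{Sym}^2(V^* )$. *)

theory Defs
  imports "Jordan_Normal_Form.Matrix" "HOL-Computational_Algebra.Polynomial" "HOL-Library.FuncSet"
begin

definition GL :: "nat \<Rightarrow> 'k::field mat monoid" where
  "GL N = units_of (ring_mat TYPE('k) N ())"

definition sym_mats :: "nat \<Rightarrow> 'k::field mat set" where
  "sym_mats N = {A \<in> carrier_mat N N. transpose_mat A = A}"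

(* A point is a pair of tuples (Q, R), with Q indexed by {1..d1} and R by {1..d2}.
   For V = k^N, the Q_i represent elements of Sym^2(V) and the R_j elements of Sym^2 of
   the dual of V. *)
type_synonym 'k sym_pair = "(nat \<Rightarrow> 'k mat) \<times> (nat \<Rightarrow> 'k mat)"

definition W_space :: "nat \<Rightarrow> nat \<Rightarrow> nat \<Rightarrow> 'k::field sym_pair set" where
  "W_space N d1 d2 = ({1..d1} \<rightarrow>\<^sub>E sym_mats N) \<times> ({1..d2} \<rightarrow>\<^sub>E sym_mats N)"

definition GL_act :: "nat \<Rightarrow> nat \<Rightarrow> nat \<Rightarrow> 'k::field mat \<Rightarrow> 'k sym_pair \<Rightarrow> 'k sym_pair" where
  "GL_act N d1 d2 g w =
    (\<lambda>i\<in>{1..d1}. g * fst w i * transpose_mat g,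
     \<lambda>j\<in>{1..d2}. transpose_mat (inv\<^bsub>GL N\<^esub> g) * snd w j * (inv\<^bsub>GL N\<^esub> g))"

(* Functions on X are represented extensionally (undefined outside X), so that equality of
   HOL functions is equality on X. This is the unital k-subalgebra generated by S. *)
inductive_set gen_algebra :: "'a set \<Rightarrow> ('a \<Rightarrow> 'k::field) set \<Rightarrow> ('a \<Rightarrow> 'k) set"
  for X :: "'a set" and S :: "('a \<Rightarrow> 'k) set" where
  const: "(\<lambda>x\<in>X. c) \<in> gen_algebra X S"
| gen: "f \<in> S \<Longrightarrow> (\<lambda>x\<in>X. f x) \<in> gen_algebra X S"
| add: "f \<in> gen_algebra X S \<Longrightarrow> h \<in> gen_algebra X S \<Longrightarrow> (\<lambda>x\<in>X. f x + h x) \<in> gen_algebra X S"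
| mult: "f \<in> gen_algebra X S \<Longrightarrow> h \<in> gen_algebra X S \<Longrightarrow> (\<lambda>x\<in>X. f x * h x) \<in> gen_algebra X S"

(* The matrix entries span the dual space of W. *)
definition coordinate_functions :: "nat \<Rightarrow> nat \<Rightarrow> nat \<Rightarrow> ('k::field sym_pair \<Rightarrow> 'k) set" where
  "coordinate_functions N d1 d2 =
    {(\<lambda>w. fst w i $$ (a, b)) | i a b. i \<in> {1..d1} \<and> a < N \<and> b < N} \<union>
    {(\<lambda>w. snd w j $$ (a, b)) | j a b. j \<in> {1..d2} \<and> a < N \<and> b < N}"

definition polynomial_functions :: "nat \<Rightarrow> nat \<Rightarrow> nat \<Rightarrow> ('k::field sym_pair \<Rightarrow> 'k) set" where
  "polynomial_functions N d1 d2 =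
    gen_algebra (W_space N d1 d2) (coordinate_functions N d1 d2)"

definition invariant_functions :: "nat \<Rightarrow> nat \<Rightarrow> nat \<Rightarrow> ('k::field sym_pair \<Rightarrow> 'k) set" where
  "invariant_functions N d1 d2 =
    {f \<in> polynomial_functions N d1 d2.
      \<forall>g \<in> carrier (GL N). \<forall>w \<in> W_space N d1 d2. f (GL_act N d1 d2 g w) = f w}"

definition mat_trace :: "'k::field mat \<Rightarrow> 'k" where
  "mat_trace A = (\<Sum>i<dim_row A. A $$ (i, i))"

(* For ps = [(n_1, m_1), ..., (n_l, m_l)] this is Tr((Q_{n_1} R_{m_1}) ... (Q_{n_l} R_{m_l})). *)
definition trace_function :: "nat \<Rightarrow> (nat \<times> nat) list \<Rightarrow> 'k::field sym_pair \<Rightarrow> 'k" where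
  "trace_function N ps w =
    mat_trace (foldr (*) (map (\<lambda>(n, m). fst w n * snd w m) ps) (1\<^sub>m N))"

end

theory Submission
  imports Defs "Jordan_Normal_Form.Char_Poly" "HOL-Combinatorics.Permutations"
begin

text \<open>A polynomial invariant splits into bihomogeneous components, each again invariant. The scalar
  matrix 2 multiplies the component of bidegree \<open>(p, q)\<close> by \<open>4 ^ p / 4 ^ q\<close>, so only the components with
  \<open>p = q = m\<close> survive. Full polarization turns such a component into invariant multilinear forms in \<open>m\<close>
  matrices of the first kind and \<open>m\<close> of the second; after composition with symmetrization they make sense
  for arbitrary matrices. Their coefficient tensors are operators on the \<open>2m\<close>-th tensor power commuting
  with all \<open>g \<otimes> \<dots> \<otimes> g\<close>, hence linear combinations of permutations of the factors. Contracting
  a permutation against symmetric matrices glues the indices into alternating cycles, and each cycle is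
  the trace of a product of matrices \<open>Q\<^sub>n R\<^sub>m\<close>.\<close>

section \<open>Polarization\<close>

text \<open>Two obstacles shape the argument. Invariance is known only at symmetric matrices,
  whereas a coefficient tensor is read off at elementary matrices, most of which are not symmetric.
  Symmetrization commutes with X -> g X g^t, so composing with it extends the form to all matrices
  without losing invariance. The other obstacle is the double commutant theorem, which is reached
  here without semisimplicity: commutation extends from invertible to all matrices because X + tI is
  singular for finitely many t only; Ryser's formula for the permanent writes symmetrized elementary
  operators as signed sums of tensor powers; and some linear projection onto the span of the
  permutation operators turns commutation into an explicit expansion. The same permanent formula is
  the polarization identity: the multilinear form is a signed sum of values of the polynomial at
  sums of arguments, and so inherits its invariance. Characteristic zero enters through division by
  2 and by factorials, through the infinitude of the field and through the distinctness of the
  powers of 4.\<close>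

lemma sum_neg_one_supersets:
  assumes "finite K" "R \<subseteq> K"
  shows "(\<Sum>S | R \<subseteq> S \<and> S \<subseteq> K. (-1) ^ (card K - card S)) =
           (if R = K then 1 else (0::'a::comm_ring_1))"
proof -
  have *: "(\<Sum>S | R \<subseteq> S \<and> S \<subseteq> K. (-1) ^ (card K - card S)) =
      (\<Sum>T\<in>Pow (K - R). (-1) ^ card T :: 'a)"
    by (rule sum.reindex_bij_witness[of _ "\<lambda>T. K - T" "\<lambda>S. K - S"])
       (use assms in \<open>auto simp: card_Diff_subset finite_subset double_diff\<close>)
  have "(\<Sum>T\<in>Pow A. (-1) ^ card T) = (if A = {} then 1 else (0::'a))" if "finite A" for A :: "'b set"
    using that
  proof (induction A)
    case (insert x A)
    have "(\<Sum>T\<in>Pow (insert x A). (-1) ^ card T) =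
        (\<Sum>T\<in>Pow A. (-1) ^ card T) + (\<Sum>T\<in>insert x ` Pow A. (-1) ^ card T :: 'a)"
      unfolding Pow_insert by (rule sum.union_disjoint) (use insert in auto)
    also have "(\<Sum>T\<in>insert x ` Pow A. (-1) ^ card T :: 'a) = (\<Sum>T\<in>Pow A. (-1) ^ Suc (card T))"
    proof (subst sum.reindex)
      show "inj_on (insert x) (Pow A)" using insert(2) by (auto simp: inj_on_def)
      show "sum ((\<lambda>T. (-1) ^ card T) \<circ> insert x) (Pow A) = (\<Sum>T\<in>Pow A. (-1) ^ Suc (card T) :: 'a)"
      proof (intro sum.cong refl)
        fix T assume "T \<in> Pow A"
        then have "finite T" "x \<notin> T" using insert(1,2) finite_subset by auto
        then show "((\<lambda>T. (-1) ^ card T) \<circ> insert x) T = ((-1) ^ Suc (card T) :: 'a)" by simp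
      qed
    qed
    finally show ?case by (simp add: sum_negf)
  qed simp
  from this[of "K - R"] show ?thesis using * assms by auto
qed

text \<open>Ryser's formula for the permanent. Expanding the product gives a sum over maps
  \<open>f\<close> from \<open>H\<close> to itself; the alternating sum over the sets
  \<open>S\<close> containing the image of \<open>f\<close> cancels unless \<open>f\<close> is onto,
  hence a permutation. With indicators as entries the formula yields symmetrized operators, with
  coordinates as entries it polarizes a monomial.\<close>

lemma polarization:
  fixes a :: "'h \<Rightarrow> 'h \<Rightarrow> 'k::comm_ring_1"
  assumes "finite H"
  shows "(\<Sum>S\<in>Pow H. (-1) ^ (card H - card S) * (\<Prod>h\<in>H. \<Sum>k\<in>S. a h k)) =
           (\<Sum>p | p permutes H. \<Prod>h\<in>H. a h (p h))"
proof -
  define F where "F = PiE H (\<lambda>_. H)"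
  have fF: "finite F" unfolding F_def using assms by (intro finite_PiE) auto
  have "(\<Sum>S\<in>Pow H. (-1) ^ (card H - card S) * (\<Prod>h\<in>H. \<Sum>k\<in>S. a h k)) =
        (\<Sum>S\<in>Pow H. \<Sum>f\<in>F. if f ` H \<subseteq> S then (-1) ^ (card H - card S) * (\<Prod>h\<in>H. a h (f h)) else 0)"
  proof (intro sum.cong refl)
    fix S assume S: "S \<in> Pow H"
    then have "finite S" using assms finite_subset by blast
    then have "(\<Prod>h\<in>H. \<Sum>k\<in>S. a h k) = (\<Sum>f\<in>PiE H (\<lambda>_. S). \<Prod>h\<in>H. a h (f h))"
      using assms by (intro prod_sum_PiE) auto
    also have "PiE H (\<lambda>_. S) = {f\<in>F. f ` H \<subseteq> S}"
      using S by (auto simp: F_def PiE_iff) (auto simp: extensional_def)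
    also have "(\<Sum>f\<in>{f\<in>F. f ` H \<subseteq> S}. \<Prod>h\<in>H. a h (f h)) =
        (\<Sum>f\<in>F. if f ` H \<subseteq> S then \<Prod>h\<in>H. a h (f h) else 0)"
      using fF by (simp add: sum.inter_filter)
    finally show "(-1) ^ (card H - card S) * (\<Prod>h\<in>H. \<Sum>k\<in>S. a h k) =
      (\<Sum>f\<in>F. if f ` H \<subseteq> S then (-1) ^ (card H - card S) * (\<Prod>h\<in>H. a h (f h)) else 0)"
      by (simp add: sum_distrib_left if_distrib cong: if_cong)
  qed
  also have "\<dots> = (\<Sum>f\<in>F. (\<Sum>S | f ` H \<subseteq> S \<and> S \<subseteq> H. (-1) ^ (card H - card S)) * (\<Prod>h\<in>H. a h (f h)))"
  proof (subst sum.swap, intro sum.cong refl)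
    fix f
    have S: "{S. f ` H \<subseteq> S \<and> S \<subseteq> H} = {S\<in>Pow H. f ` H \<subseteq> S}" by auto
    show "(\<Sum>S\<in>Pow H. if f ` H \<subseteq> S then (-1) ^ (card H - card S) * (\<Prod>h\<in>H. a h (f h)) else 0) =
      (\<Sum>S | f ` H \<subseteq> S \<and> S \<subseteq> H. (-1) ^ (card H - card S)) * (\<Prod>h\<in>H. a h (f h))"
      unfolding S sum_distrib_right by (rule sum.inter_filter[symmetric]) (use assms in simp)
  qed
  also have "\<dots> = (\<Sum>f\<in>F. if f ` H = H then \<Prod>h\<in>H. a h (f h) else 0)"
  proof (intro sum.cong refl)
    fix f assume "f \<in> F"
    then have "f ` H \<subseteq> H" by (auto simp: F_def)
    then show "(\<Sum>S | f ` H \<subseteq> S \<and> S \<subseteq> H. (-1) ^ (card H - card S)) * (\<Prod>h\<in>H. a h (f h)) =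
        (if f ` H = H then \<Prod>h\<in>H. a h (f h) else 0)"
      using sum_neg_one_supersets[OF assms, of "f ` H", where 'a='k] by auto
  qed
  also have "\<dots> = (\<Sum>f\<in>{f\<in>F. f ` H = H}. \<Prod>h\<in>H. a h (f h))"
    using fF by (simp add: sum.inter_filter)
  also have "\<dots> = (\<Sum>p | p permutes H. \<Prod>h\<in>H. a h (p h))"
  \<comment> \<open>Outside \<open>H\<close> a member of \<open>PiE\<close> is undefined while a
    permutation is the identity; the two witnesses translate between these conventions.\<close>
  proof (rule sum.reindex_bij_witness[of _ "\<lambda>p. restrict p H" "\<lambda>f x. if x \<in> H then f x else x"])
    fix f assume f: "f \<in> {f\<in>F. f ` H = H}"
    then show "restrict (\<lambda>x. if x \<in> H then f x else x) H = f"
      by (auto simp: F_def fun_eq_iff PiE_iff extensional_def)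
    have "inj_on f H" using f assms by (auto intro: eq_card_imp_inj_on)
    then have "bij_betw f H H" using f by (auto simp: bij_betw_def)
    then have "bij_betw (\<lambda>x. if x \<in> H then f x else x) H H"
      by (subst bij_betw_cong[of _ _ f]) auto
    then show "(\<lambda>x. if x \<in> H then f x else x) \<in> {p. p permutes H}"
      by (auto intro: bij_imp_permutes)
    show "(\<Prod>h\<in>H. a h (if h \<in> H then f h else h)) = (\<Prod>h\<in>H. a h (f h))"
      by (intro prod.cong) auto
  next
    fix p assume p: "p \<in> {p. p permutes H}"
    then show "(\<lambda>x. if x \<in> H then restrict p H x else x) = p"
      by (auto simp: permutes_def)
    show "restrict p H \<in> {f\<in>F. f ` H = H}" using p permutes_image[of p H]
      by (auto simp: F_def permutes_in_image)
  qed
  finally show ?thesis .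
qed

lemma permutes_comp_PiE:
  assumes "p permutes H" "I \<in> PiE H (\<lambda>_. B)"
  shows "I \<circ> p \<in> PiE H (\<lambda>_. B)"
  using assms by (auto simp: PiE_iff extensional_def permutes_in_image permutes_not_in)

lemma sum_PiE_permute:
  assumes p: "p permutes H"
  shows "(\<Sum>I\<in>PiE H (\<lambda>_. B). f (I \<circ> p)) = (\<Sum>I\<in>PiE H (\<lambda>_. B). f I)"
  by (rule sum.reindex_bij_witness[of _ "\<lambda>I. I \<circ> Hilbert_Choice.inv p" "\<lambda>I. I \<circ> p"])
     (use permutes_comp_PiE[OF p] permutes_comp_PiE[OF permutes_inv[OF p]] in
       \<open>simp_all add: comp_assoc permutes_inv_o[OF p]\<close>)

text \<open>The kernel \<open>\<Sum>i\<in>A. c i z' * v i z\<close> has its columns in the span of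
  the \<open>v i\<close> and fixes each of them. This projection is built one vector at a time by
  rank-one corrections; no inner product is involved, so any field will do.\<close>

lemma exists_linear_projection:
  fixes v :: "'i \<Rightarrow> 'z \<Rightarrow> 'k::field"
  assumes "finite A" "finite Z"
  shows "\<exists>c. \<forall>j\<in>A. \<forall>z\<in>Z. (\<Sum>z'\<in>Z. (\<Sum>i\<in>A. c i z' * v i z) * v j z') = v j z"
  using assms(1)
proof (induction A)
  case (insert j0 A)
  then obtain c where c: "\<forall>j\<in>A. \<forall>z\<in>Z. (\<Sum>z'\<in>Z. (\<Sum>i\<in>A. c i z' * v i z) * v j z') = v j z" by blast
  define p where "p z z' = (\<Sum>i\<in>A. c i z' * v i z)" for z z'
  have p: "(\<Sum>z'\<in>Z. p z z' * v j z') = v j z" if "j \<in> A" "z \<in> Z" for j z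
    using c that by (simp add: p_def)
  define m where "m i = (\<Sum>z'\<in>Z. c i z' * v j0 z')" for i
  define u where "u z = v j0 z - (\<Sum>i\<in>A. m i * v i z)" for z
  have pu: "(\<Sum>z'\<in>Z. p z z' * v j0 z') = v j0 z - u z" for z
    unfolding u_def p_def m_def sum_distrib_right sum_distrib_left
    by (subst sum.swap) (simp add: algebra_simps)
  define x where "x = (SOME x. x \<in> Z \<and> u x \<noteq> 0)"
  have x: "x \<in> Z \<and> u x \<noteq> 0" if "\<exists>x\<in>Z. u x \<noteq> 0"
    unfolding x_def using someI_ex[of "\<lambda>x. x \<in> Z \<and> u x \<noteq> 0"] that by blast
  \<comment> \<open>Coordinate \<open>x\<close> of the defect, divided by \<open>u x\<close>, as a
    functional: it kills the old \<open>v j\<close>, which the old projection fixes, and is 1 on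
    \<open>v j0\<close>. Adding \<open>r z' * u z\<close> to the kernel makes \<open>v j0\<close>
    fixed as well; the default 0 leaves the kernel unchanged.\<close>
  define r where "r z' = (if \<exists>x\<in>Z. u x \<noteq> 0 then ((if x = z' then 1 else 0) - p x z') / u x else 0)" for z'
  define c' where "c' i z' = (if i = j0 then r z' else c i z' - r z' * m i)" for i z'
  have eq: "(\<Sum>i\<in>insert j0 A. c' i z' * v i z) = p z z' + r z' * u z" for z z'
  proof -
    have "(\<Sum>i\<in>insert j0 A. c' i z' * v i z) = r z' * v j0 z + (\<Sum>i\<in>A. (c i z' - r z' * m i) * v i z)"
      using insert(1,2) by (simp add: c'_def) (rule sum.cong, auto)
    also have "\<dots> = p z z' + r z' * u z"
      by (simp add: p_def u_def algebra_simps sum_subtractf sum_distrib_left)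
    finally show ?thesis .
  qed
  have r: "(\<Sum>z'\<in>Z. r z' * v j z') = (v j x - (\<Sum>z'\<in>Z. p x z' * v j z')) / u x" if "\<exists>x\<in>Z. u x \<noteq> 0" for j
  proof -
    have "(\<Sum>z'\<in>Z. r z' * v j z') = (\<Sum>z'\<in>Z. ((if x = z' then v j z' else 0) - p x z' * v j z') / u x)"
      using that by (intro sum.cong) (auto simp: r_def field_simps)
    also have "\<dots> = (v j x - (\<Sum>z'\<in>Z. p x z' * v j z')) / u x"
      using x[OF that] assms(2) by (simp add: sum_subtractf flip: sum_divide_distrib)
    finally show ?thesis .
  qed
  have "(\<Sum>z'\<in>Z. (\<Sum>i\<in>insert j0 A. c' i z' * v i z) * v j z') = v j z"
    if "j \<in> insert j0 A" "z \<in> Z" for j z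
  proof -
    have "(\<Sum>z'\<in>Z. (\<Sum>i\<in>insert j0 A. c' i z' * v i z) * v j z') =
        (\<Sum>z'\<in>Z. p z z' * v j z') + (\<Sum>z'\<in>Z. r z' * v j z') * u z"
      by (simp add: eq algebra_simps sum.distrib sum_distrib_left)
    also have "\<dots> = v j z"
    proof (cases "\<exists>x\<in>Z. u x \<noteq> 0")
      case True
      then show ?thesis using that x[OF True] p pu by (cases "j = j0") (auto simp: r[OF True])
    next
      case False
      then have "r = (\<lambda>_. 0)" by (auto simp: r_def)
      then show ?thesis using that False p pu by (cases "j = j0") auto
    qed
    finally show ?thesis .
  qed
  then show ?case by blast
qed simp

section \<open>The commutant of the tensor powers\<close>

definition inverse_pair :: "nat \<Rightarrow> (nat \<Rightarrow> nat \<Rightarrow> 'k::field) \<Rightarrow> (nat \<Rightarrow> nat \<Rightarrow> 'k) \<Rightarrow> bool" where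
  "inverse_pair N g g' \<longleftrightarrow>
     (\<forall>a<N. \<forall>b<N. (\<Sum>c<N. g a c * g' c b) = of_bool (a = b) \<and>
                    (\<Sum>c<N. g' a c * g c b) = of_bool (a = b))"

definition tensor_power :: "'h set \<Rightarrow> ('i \<Rightarrow> 'i \<Rightarrow> 'k::comm_ring_1) \<Rightarrow> ('h \<Rightarrow> 'i) \<Rightarrow> ('h \<Rightarrow> 'i) \<Rightarrow> 'k" where
  "tensor_power H X I J = (\<Prod>h\<in>H. X (I h) (J h))"

definition commutes_on :: "'a set \<Rightarrow> ('a \<Rightarrow> 'a \<Rightarrow> 'k::comm_ring_1) \<Rightarrow> ('a \<Rightarrow> 'a \<Rightarrow> 'k) \<Rightarrow> bool" where
  "commutes_on W C B \<longleftrightarrow>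
     (\<forall>I\<in>W. \<forall>J\<in>W. (\<Sum>K\<in>W. B I K * C K J) = (\<Sum>K\<in>W. C I K * B K J))"

abbreviation words :: "'h set \<Rightarrow> nat \<Rightarrow> ('h \<Rightarrow> nat) set" where
  "words H N \<equiv> PiE H (\<lambda>_. {..<N})"

lemma finite_words: "finite H \<Longrightarrow> finite (words H N)"
  by (intro finite_PiE) auto

text \<open>A shift can be singular only at an eigenvalue of the matrix -X, that is, at a root of
  one nonzero polynomial; hence the sign in \<open>A\<close>.\<close>

lemma finite_noninvertible_shifts:
  fixes X :: "nat \<Rightarrow> nat \<Rightarrow> 'k::field"
  shows "finite {t. \<not> (\<exists>g'. inverse_pair N (\<lambda>a b. X a b + t * of_bool (a = b)) g')}"
proof -
  define A where "A = mat N N (\<lambda>(a, b). - X a b)"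
  have A: "A \<in> carrier_mat N N" by (simp add: A_def)
  have "char_poly A \<noteq> 0" using degree_monic_char_poly[OF A] by auto
  then have "finite {t. poly (char_poly A) t = 0}" by (rule poly_roots_finite)
  moreover have "\<exists>g'. inverse_pair N (\<lambda>a b. X a b + t * of_bool (a = b)) g'"
    if t: "poly (char_poly A) t \<noteq> 0" for t
  proof -
    define G where "G = - char_matrix A t"
    have G: "G \<in> carrier_mat N N" using A by (simp add: G_def char_matrix_def)
    have Gi: "G $$ (a, b) = X a b + t * of_bool (a = b)" if "a < N" "b < N" for a b
      using that by (simp add: G_def char_matrix_def A_def)
    have "det G \<noteq> 0" using t char_poly_matrix[OF A, of t] by (simp add: G_def)
    from det_non_zero_imp_unit[OF G this, of "()"] obtain B where
      B: "B \<in> carrier_mat N N" "B * G = 1\<^sub>m N" "G * B = 1\<^sub>m N"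
      by (auto simp: Units_def ring_mat_def)
    have "(\<Sum>c<N. (X a c + t * of_bool (a = c)) * B $$ (c, b)) = of_bool (a = b) \<and>
          (\<Sum>c<N. B $$ (a, c) * (X c b + t * of_bool (c = b))) = of_bool (a = b)"
      if ab: "a < N" "b < N" for a b
    proof -
      have "(G * B) $$ (a, b) = of_bool (a = b)" "(B * G) $$ (a, b) = of_bool (a = b)"
        using B ab by auto
      moreover have "(G * B) $$ (a, b) = (\<Sum>c<N. (X a c + t * of_bool (a = c)) * B $$ (c, b))"
        "(B * G) $$ (a, b) = (\<Sum>c<N. B $$ (a, c) * (X c b + t * of_bool (c = b)))"
        using ab G B(1) by (auto simp: scalar_prod_def atLeast0LessThan Gi simp del: of_bool_eq_iff intro!: sum.cong)
      ultimately show ?thesis by simp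
    qed
    then show ?thesis unfolding inverse_pair_def by (intro exI[of _ "\<lambda>a b. B $$ (a, b)"]) auto
  qed
  then have "{t. \<not> (\<exists>g'. inverse_pair N (\<lambda>a b. X a b + t * of_bool (a = b)) g')} \<subseteq>
    {t. poly (char_poly A) t = 0}" by blast
  ultimately show ?thesis by (rule finite_subset[rotated])
qed

text \<open>Density of the invertible matrices along a line: for X + tI each entry of the difference
  of the two sides is a polynomial in t vanishing at all but finitely many points of an infinite
  field, so it vanishes at t = 0 too.\<close>

lemma commutes_on_tensor_power:
  fixes C :: "('h \<Rightarrow> nat) \<Rightarrow> ('h \<Rightarrow> nat) \<Rightarrow> 'k::field_char_0"
  assumes "\<And>g g'. inverse_pair N g g' \<Longrightarrow> commutes_on (words H N) C (tensor_power H g)"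
  shows "commutes_on (words H N) C (tensor_power H X)"
proof -
  let ?W = "words H N"
  have "(\<Sum>K\<in>?W. tensor_power H X I K * C K J) = (\<Sum>K\<in>?W. C I K * tensor_power H X K J)"
    if IJ: "I \<in> ?W" "J \<in> ?W" for I J
  proof -
    define q where "q I K = (\<Prod>h\<in>H. [:X (I h) (K h), of_bool (I h = K h):])" for I K
    define p where "p = (\<Sum>K\<in>?W. q I K * [:C K J:]) - (\<Sum>K\<in>?W. [:C I K:] * q K J)"
    define Y where "Y t a b = X a b + t * of_bool (a = b)" for t a b
    have q: "poly (q I K) t = tensor_power H (Y t) I K" for I K t
      by (simp add: q_def tensor_power_def poly_prod Y_def)
    have p: "poly p t = (\<Sum>K\<in>?W. tensor_power H (Y t) I K * C K J) -
        (\<Sum>K\<in>?W. C I K * tensor_power H (Y t) K J)" for t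
      by (simp add: p_def poly_sum q mult.commute)
    have "poly p t = 0" if "\<exists>g'. inverse_pair N (Y t) g'" for t
    proof -
      from that obtain g' where "inverse_pair N (Y t) g'" by blast
      from assms[OF this] IJ show ?thesis unfolding p commutes_on_def by simp
    qed
    then have "{t. poly p t \<noteq> 0} \<subseteq> {t. \<not> (\<exists>g'. inverse_pair N (Y t) g')}" by auto
    then have fin: "finite {t. poly p t \<noteq> 0}"
      using finite_noninvertible_shifts[of N X] unfolding Y_def by (rule finite_subset)
    have "p = 0"
    proof (rule ccontr)
      assume "p \<noteq> 0"
      then have "finite {t. poly p t = 0}" by (rule poly_roots_finite)
      then have "finite ({t. poly p t = 0} \<union> {t. poly p t \<noteq> 0})" using fin by simp
      moreover have "{t. poly p t = 0} \<union> {t. poly p t \<noteq> 0} = UNIV" by auto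
      ultimately show False using infinite_UNIV_char_0[where 'a='k] by simp
    qed
    moreover have "Y 0 = X" by (simp add: Y_def fun_eq_iff)
    ultimately show ?thesis using p[of 0] by simp
  qed
  then show ?thesis unfolding commutes_on_def by auto
qed

lemma sum_swap_outer:
  "(\<Sum>i\<in>A. \<Sum>j\<in>B. \<Sum>k\<in>C. f i j k) = (\<Sum>k\<in>C. \<Sum>i\<in>A. \<Sum>j\<in>B. f i j k)"
proof -
  have "(\<Sum>i\<in>A. \<Sum>j\<in>B. \<Sum>k\<in>C. f i j k) = (\<Sum>i\<in>A. \<Sum>k\<in>C. \<Sum>j\<in>B. f i j k)"
    by (intro sum.cong refl sum.swap)
  also have "\<dots> = (\<Sum>k\<in>C. \<Sum>i\<in>A. \<Sum>j\<in>B. f i j k)" by (rule sum.swap)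
  finally show ?thesis .
qed

lemma sum_mult_of_bool:
  "finite A \<Longrightarrow> (\<Sum>j\<in>A. f j * of_bool (i = j)) = (if i \<in> A then f i else (0::'a::comm_semiring_1))"
  by (simp add: of_bool_def if_distrib[of "(*) _"] cong: if_cong)

text \<open>Each permutation \<open>p\<close> contributes the elementary operator with row word
  \<open>K \<circ> p\<close> and column word \<open>L \<circ> p\<close>. Ryser's formula turns this
  orbit sum into tensor powers, to which a commutation hypothesis applies.\<close>

lemma tensor_power_elementary_sum:
  assumes "finite H"
  shows "(\<Sum>p | p permutes H. \<Prod>h\<in>H. of_bool (I h = K (p h)) * of_bool (J h = L (p h))) =
    (\<Sum>S\<in>Pow H. (-1) ^ (card H - card S) *
       tensor_power H (\<lambda>a b. \<Sum>k\<in>S. of_bool (a = K k) * of_bool (b = L k) :: 'k::field_char_0) I J)"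
  unfolding tensor_power_def by (rule polarization[OF assms, symmetric])

lemma prod_of_bool_eq:
  assumes "finite H" "I \<in> PiE H A" "J \<in> PiE H A"
  shows "(\<Prod>h\<in>H. of_bool (I h = J h)) = (of_bool (I = J) :: 'k::field)"
proof (cases "I = J")
  case False
  then obtain h where "h \<in> H" "I h \<noteq> J h" using PiE_ext[OF assms(2,3)] by blast
  then show ?thesis using False assms(1) by (subst prod_zero) auto
qed simp

text \<open>The operators commuting with the symmetric group are spanned by polarized tensor powers.\<close>

lemma commutes_on_permutation_invariant:
  fixes C :: "('h \<Rightarrow> nat) \<Rightarrow> ('h \<Rightarrow> nat) \<Rightarrow> 'k::field_char_0"
  assumes H: "finite H"
    and C: "\<And>X. commutes_on (words H N) C (tensor_power H X)"
    and B: "\<And>p I J. p permutes H \<Longrightarrow> I \<in> words H N \<Longrightarrow> J \<in> words H N \<Longrightarrow> B (I \<circ> p) (J \<circ> p) = B I J"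
  shows "commutes_on (words H N) C B"
proof -
  let ?W = "words H N"
  let ?P = "{p. p permutes H}"
  have fW: "finite ?W" by (rule finite_words[OF H])
  have fP: "finite ?P" using H by (rule finite_permutations)
  define E where "E K L I J = (\<Sum>S\<in>Pow H. (-1) ^ (card H - card S) *
       tensor_power H (\<lambda>a b. \<Sum>k\<in>S. of_bool (a = K k) * of_bool (b = L k) :: 'k) I J)" for K L I J :: "'h \<Rightarrow> nat"
  have E: "E K L I J = (\<Sum>p\<in>?P. of_bool (I = K \<circ> p) * of_bool (J = L \<circ> p))"
    if W: "I \<in> ?W" "J \<in> ?W" "K \<in> ?W" "L \<in> ?W" for I J K L
    unfolding E_def tensor_power_elementary_sum[OF H, symmetric] prod.distrib
  proof (intro sum.cong refl)
    fix p assume "p \<in> ?P"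
    then have "K \<circ> p \<in> ?W" "L \<circ> p \<in> ?W" using W permutes_comp_PiE by blast+
    from prod_of_bool_eq[OF H W(1) this(1), where 'k='k] prod_of_bool_eq[OF H W(2) this(2), where 'k='k]
    show "(\<Prod>h\<in>H. of_bool (I h = K (p h))) * (\<Prod>h\<in>H. of_bool (J h = L (p h))) =
      (of_bool (I = K \<circ> p) * of_bool (J = L \<circ> p) :: 'k)" by (simp only: comp_apply)
  qed
  \<comment> \<open>The double sum meets each elementary operator once per permutation, every time
    with the same coefficient of \<open>B\<close>; hence the factor \<open>card ?P\<close>, which is
    nonzero in the field.\<close>
  have expand: "of_nat (card ?P) * B I J = (\<Sum>K\<in>?W. \<Sum>L\<in>?W. B K L * E K L I J)"
    if W: "I \<in> ?W" "J \<in> ?W" for I J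
  proof -
    have "(\<Sum>K\<in>?W. \<Sum>L\<in>?W. B K L * E K L I J) =
        (\<Sum>K\<in>?W. \<Sum>L\<in>?W. \<Sum>p\<in>?P. B (K \<circ> p) (L \<circ> p) * (of_bool (I = K \<circ> p) * of_bool (J = L \<circ> p)))"
    proof (intro sum.cong refl)
      fix K L assume KL: "K \<in> ?W" "L \<in> ?W"
      show "B K L * E K L I J = (\<Sum>p\<in>?P. B (K \<circ> p) (L \<circ> p) * (of_bool (I = K \<circ> p) * of_bool (J = L \<circ> p)))"
        unfolding E[OF W KL] sum_distrib_left using B[OF _ KL] by (intro sum.cong refl) (simp only: mem_Collect_eq)
    qed
    also have "\<dots> = (\<Sum>p\<in>?P. \<Sum>K\<in>?W. \<Sum>L\<in>?W. B (K \<circ> p) (L \<circ> p) * (of_bool (I = K \<circ> p) * of_bool (J = L \<circ> p)))"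
      by (rule sum_swap_outer)
    also have "\<dots> = (\<Sum>p\<in>?P. \<Sum>K\<in>?W. \<Sum>L\<in>?W. B K L * (of_bool (I = K) * of_bool (J = L)))"
    proof (rule sum.cong[OF refl])
      fix p assume "p \<in> ?P"
      then have p: "p permutes H" by simp
      show "(\<Sum>K\<in>?W. \<Sum>L\<in>?W. B (K \<circ> p) (L \<circ> p) * (of_bool (I = K \<circ> p) * of_bool (J = L \<circ> p))) =
        (\<Sum>K\<in>?W. \<Sum>L\<in>?W. B K L * (of_bool (I = K) * of_bool (J = L)))"
        by (subst sum_PiE_permute[OF p, of "\<lambda>K. \<Sum>L\<in>?W. B K (L \<circ> p) * (of_bool (I = K) * of_bool (J = L \<circ> p))"],
            rule sum.cong[OF refl], rule sum_PiE_permute[OF p])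
    qed
    also have "\<dots> = (\<Sum>p\<in>?P. B I J)"
      using W fW by (intro sum.cong refl) (simp only: mult.assoc[symmetric] sum_mult_of_bool if_True)
    finally show ?thesis by simp
  qed
  have comm: "(\<Sum>M\<in>?W. E K L I M * C M J) = (\<Sum>M\<in>?W. C I M * E K L M J)"
    if W: "I \<in> ?W" "J \<in> ?W" for I J K L
  proof -
    define T where "T S = tensor_power H (\<lambda>a b. \<Sum>k\<in>S. of_bool (a = K k) * of_bool (b = L k) :: 'k)" for S
    have T: "(\<Sum>M\<in>?W. T S I M * C M J) = (\<Sum>M\<in>?W. C I M * T S M J)" for S
      using C W unfolding T_def commutes_on_def by blast
    have "(\<Sum>M\<in>?W. E K L I M * C M J) =
        (\<Sum>S\<in>Pow H. (-1) ^ (card H - card S) * (\<Sum>M\<in>?W. T S I M * C M J))"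
      unfolding E_def T_def sum_distrib_left sum_distrib_right
      by (subst sum.swap) (simp only: mult.assoc)
    also have "\<dots> = (\<Sum>M\<in>?W. C I M * E K L M J)"
      unfolding T unfolding E_def T_def sum_distrib_left
      by (subst sum.swap) (simp only: mult.left_commute)
    finally show ?thesis .
  qed
  have "(\<Sum>M\<in>?W. B I M * C M J) = (\<Sum>M\<in>?W. C I M * B M J)" if W: "I \<in> ?W" "J \<in> ?W" for I J
  proof -
    have "of_nat (card ?P) * (\<Sum>M\<in>?W. B I M * C M J) = (\<Sum>M\<in>?W. (of_nat (card ?P) * B I M) * C M J)"
      by (simp add: sum_distrib_left mult.assoc)
    also have "\<dots> = (\<Sum>M\<in>?W. \<Sum>K\<in>?W. \<Sum>L\<in>?W. B K L * (E K L I M * C M J))"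
      using W by (intro sum.cong refl) (simp only: expand sum_distrib_right mult.assoc)
    also have "\<dots> = (\<Sum>K\<in>?W. \<Sum>L\<in>?W. B K L * (\<Sum>M\<in>?W. E K L I M * C M J))"
      unfolding sum_distrib_left by (rule sum_swap_outer[symmetric])
    also have "\<dots> = (\<Sum>K\<in>?W. \<Sum>L\<in>?W. B K L * (\<Sum>M\<in>?W. C I M * E K L M J))"
      by (simp only: comm[OF W])
    also have "\<dots> = (\<Sum>M\<in>?W. \<Sum>K\<in>?W. \<Sum>L\<in>?W. B K L * (C I M * E K L M J))"
      unfolding sum_distrib_left by (rule sum_swap_outer)
    also have "\<dots> = (\<Sum>M\<in>?W. C I M * (of_nat (card ?P) * B M J))"
      using W by (intro sum.cong refl) (simp only: expand sum_distrib_left mult.left_commute)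
    also have "\<dots> = of_nat (card ?P) * (\<Sum>M\<in>?W. C I M * B M J)"
      by (simp add: sum_distrib_left mult.left_commute)
    finally have "of_nat (card ?P) * (\<Sum>M\<in>?W. B I M * C M J) = of_nat (card ?P) * (\<Sum>M\<in>?W. C I M * B M J)" .
    moreover have "card ?P \<noteq> 0" using fP permutes_id[of H] by (auto simp: card_eq_0_iff simp del: permutes_id)
    ultimately show ?thesis by simp
  qed
  then show ?thesis unfolding commutes_on_def by blast
qed

text \<open>The kernel of the linear projection onto the span of the permutation operators is averaged,
  so that for fixed outer indices it commutes with all permutations, hence with \<open>C\<close>.\<close>

theorem commutant_of_tensor_powers:
  fixes C :: "('h \<Rightarrow> nat) \<Rightarrow> ('h \<Rightarrow> nat) \<Rightarrow> 'k::field_char_0"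
  assumes H: "finite H"
    and C: "\<And>g g'. inverse_pair N g g' \<Longrightarrow> commutes_on (words H N) C (tensor_power H g)"
  shows "\<exists>d. \<forall>I\<in>words H N. \<forall>J\<in>words H N.
    C I J = (\<Sum>s | s permutes H. \<Sum>t | t permutes H. d s t * of_bool (I \<circ> s = J \<circ> t))"
proof -
  let ?W = "words H N"
  let ?P = "{p. p permutes H}"
  have fW: "finite ?W" by (rule finite_words[OF H])
  have fP: "finite ?P" using H by (rule finite_permutations)
  define n where "n = (of_nat (card ?P) :: 'k)"
  have n: "n \<noteq> 0" using fP permutes_id[of H] by (auto simp: n_def card_eq_0_iff simp del: permutes_id)
  \<comment> \<open>Permutation operators become vectors indexed by pairs of words, so that the
    projection lemma applies to their span.\<close>
  define v where "v s z = (of_bool (fst z \<circ> s = snd z) :: 'k)" for s and z :: "('h \<Rightarrow> nat) \<times> ('h \<Rightarrow> nat)"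
  obtain c where c: "\<And>j z. j \<in> ?P \<Longrightarrow> z \<in> ?W \<times> ?W \<Longrightarrow>
      (\<Sum>z'\<in>?W \<times> ?W. (\<Sum>i\<in>?P. c i z' * v i z) * v j z') = v j z"
    using exists_linear_projection[OF fP finite_cartesian_product[OF fW fW], of v] by blast
  define p where "p I J I' J' = (\<Sum>s\<in>?P. c s (I', J') * v s (I, J))" for I J I' J'
  have p: "(\<Sum>I'\<in>?W. \<Sum>J'\<in>?W. p I J I' J' * of_bool (I' \<circ> t = J')) = of_bool (I \<circ> t = J)"
    if "t \<in> ?P" "I \<in> ?W" "J \<in> ?W" for t I J
  proof -
    have "(\<Sum>I'\<in>?W. \<Sum>J'\<in>?W. p I J I' J' * of_bool (I' \<circ> t = J')) =
        (\<Sum>z'\<in>?W \<times> ?W. (\<Sum>i\<in>?P. c i z' * v i (I, J)) * v t z')"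
      unfolding sum.cartesian_product p_def v_def by (rule sum.cong[OF refl]) (simp only: split_paired_all case_prod_conv fst_conv snd_conv)
    also have "\<dots> = v t (I, J)" using that by (intro c) auto
    finally show ?thesis by (simp add: v_def)
  qed
  define B where "B I I' J' J = (\<Sum>t\<in>?P. p I (J \<circ> t) I' (J' \<circ> t))" for I I' J' J
  have com: "commutes_on ?W C (B I I')" for I I'
  proof (rule commutes_on_permutation_invariant[OF H])
    show "commutes_on ?W C (tensor_power H X)" for X by (rule commutes_on_tensor_power) (rule C)
    fix s J' J assume s: "s permutes H"
    have "(\<Sum>t\<in>?P. p I (J \<circ> (s \<circ> t)) I' (J' \<circ> (s \<circ> t))) = (\<Sum>t\<in>?P. p I (J \<circ> t) I' (J' \<circ> t))"
      by (rule setum_permutations_compose_left[OF s, symmetric])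
    then show "B I I' (J' \<circ> s) (J \<circ> s) = B I I' J' J" by (simp add: B_def comp_assoc)
  qed
  \<comment> \<open>With the second inner word equal to \<open>I' \<circ> t\<close>, the kernel is
    applied to the permutation operator of \<open>t\<close>, which the projection fixes; each of the
    \<open>n\<close> permutations thus contributes the identity.\<close>
  have one: "(\<Sum>I'\<in>?W. B I I' I' K) = n * of_bool (I = K)" if W: "I \<in> ?W" "K \<in> ?W" for I K
  proof -
    have "(\<Sum>I'\<in>?W. B I I' I' K) = (\<Sum>t\<in>?P. \<Sum>I'\<in>?W. p I (K \<circ> t) I' (I' \<circ> t))"
      unfolding B_def by (rule sum.swap)
    also have "\<dots> = (\<Sum>t\<in>?P. \<Sum>I'\<in>?W. \<Sum>J'\<in>?W. p I (K \<circ> t) I' J' * of_bool (I' \<circ> t = J'))"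
      using fW by (intro sum.cong refl)
        (simp only: sum_mult_of_bool permutes_comp_PiE mem_Collect_eq if_True)
    also have "\<dots> = (\<Sum>t\<in>?P. of_bool (I \<circ> t = K \<circ> t))"
      using W by (intro sum.cong refl p permutes_comp_PiE) simp_all
    also have "\<dots> = (\<Sum>t\<in>?P. of_bool (I = K))"
    proof (intro sum.cong refl)
      fix t assume "t \<in> ?P"
      then have t: "t \<circ> Hilbert_Choice.inv t = id" using permutes_inv_o by blast
      have "I = K" if "I \<circ> t = K \<circ> t"
      proof -
        have "(I \<circ> t) \<circ> Hilbert_Choice.inv t = (K \<circ> t) \<circ> Hilbert_Choice.inv t" using that by simp
        then show ?thesis by (simp only: comp_assoc t comp_id)
      qed
      then have "I \<circ> t = K \<circ> t \<longleftrightarrow> I = K" by blast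
      then show "of_bool (I \<circ> t = K \<circ> t) = (of_bool (I = K) :: 'k)" by (simp only:)
    qed
    also have "\<dots> = n * of_bool (I = K)" by (simp add: n_def)
    finally show ?thesis .
  qed
  \<comment> \<open>Once \<open>C\<close> has been moved past \<open>B\<close>, the words
    \<open>I\<close> and \<open>J\<close> survive only in the condition
    \<open>I \<circ> s = J \<circ> t\<close>; all other factors are collected here.\<close>
  define e where "e s t = (\<Sum>I'\<in>?W. \<Sum>K\<in>?W. C I' K * c s (I', K \<circ> t)) / n" for s t
  have e: "n * e s t = (\<Sum>I'\<in>?W. \<Sum>K\<in>?W. C I' K * c s (I', K \<circ> t))" for s t
    using n by (simp add: e_def)
  have "C I J = (\<Sum>s\<in>?P. \<Sum>t\<in>?P. e s t * of_bool (I \<circ> s = J \<circ> t))" if W: "I \<in> ?W" "J \<in> ?W" for I J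
  proof -
    have "n * C I J = (\<Sum>K\<in>?W. n * of_bool (I = K) * C K J)"
      using W sum_mult_of_bool[OF fW, of "\<lambda>K. n * C K J" I] by (simp only: mult_ac if_True)
    also have "\<dots> = (\<Sum>K\<in>?W. \<Sum>I'\<in>?W. B I I' I' K * C K J)"
      using W by (intro sum.cong refl) (simp only: one[symmetric] sum_distrib_right)
    also have "\<dots> = (\<Sum>I'\<in>?W. \<Sum>K\<in>?W. B I I' I' K * C K J)" by (rule sum.swap)
    also have "\<dots> = (\<Sum>I'\<in>?W. \<Sum>K\<in>?W. C I' K * B I I' K J)"
      by (rule sum.cong[OF refl]) (rule com[unfolded commutes_on_def, rule_format, OF _ W(2)])
    also have "\<dots> = (\<Sum>I'\<in>?W. \<Sum>K\<in>?W. \<Sum>t\<in>?P. \<Sum>s\<in>?P. C I' K * c s (I', K \<circ> t) * of_bool (I \<circ> s = J \<circ> t))"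
      unfolding B_def p_def v_def fst_conv snd_conv
      by (simp only: sum_distrib_left mult.assoc)
    also have "\<dots> = (\<Sum>t\<in>?P. \<Sum>I'\<in>?W. \<Sum>K\<in>?W. \<Sum>s\<in>?P. C I' K * c s (I', K \<circ> t) * of_bool (I \<circ> s = J \<circ> t))"
      by (rule sum_swap_outer)
    also have "\<dots> = (\<Sum>t\<in>?P. \<Sum>s\<in>?P. \<Sum>I'\<in>?W. \<Sum>K\<in>?W. C I' K * c s (I', K \<circ> t) * of_bool (I \<circ> s = J \<circ> t))"
      by (rule sum.cong[OF refl], rule sum_swap_outer)
    also have "\<dots> = (\<Sum>t\<in>?P. \<Sum>s\<in>?P. n * (e s t * of_bool (I \<circ> s = J \<circ> t)))"
      by (intro sum.cong refl) (simp only: mult.assoc[symmetric] e sum_distrib_right)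
    also have "\<dots> = n * (\<Sum>s\<in>?P. \<Sum>t\<in>?P. e s t * of_bool (I \<circ> s = J \<circ> t))"
      unfolding sum_distrib_left by (rule sum.swap)
    finally show ?thesis using n by simp
  qed
  then show ?thesis by blast
qed

section \<open>Contractions along matchings\<close>

definition in_algebra :: "'w set \<Rightarrow> ('w \<Rightarrow> 'k::field) set \<Rightarrow> ('w \<Rightarrow> 'k) \<Rightarrow> bool" where
  "in_algebra X S f \<longleftrightarrow> restrict f X \<in> gen_algebra X S"

lemma in_algebra_const: "in_algebra X S (\<lambda>w. c)"
  unfolding in_algebra_def by (rule gen_algebra.const)

lemma in_algebra_gen: "f \<in> S \<Longrightarrow> in_algebra X S f"
  unfolding in_algebra_def by (rule gen_algebra.gen)

lemma in_algebra_add: "in_algebra X S f \<Longrightarrow> in_algebra X S h \<Longrightarrow> in_algebra X S (\<lambda>w. f w + h w)"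
  unfolding in_algebra_def
  by (drule (1) gen_algebra.add) (simp cong: restrict_cong)

lemma in_algebra_mult: "in_algebra X S f \<Longrightarrow> in_algebra X S h \<Longrightarrow> in_algebra X S (\<lambda>w. f w * h w)"
  unfolding in_algebra_def
  by (drule (1) gen_algebra.mult) (simp cong: restrict_cong)

lemma in_algebra_eqI:
  "in_algebra X S f \<Longrightarrow> (\<And>w. w \<in> X \<Longrightarrow> h w = f w) \<Longrightarrow> in_algebra X S h"
  unfolding in_algebra_def by (simp cong: restrict_cong)

lemma in_algebra_sum: "(\<And>i. i \<in> A \<Longrightarrow> in_algebra X S (f i)) \<Longrightarrow> in_algebra X S (\<lambda>w. \<Sum>i\<in>A. f i w)"
proof (induction A rule: infinite_finite_induct)
  case (insert i A)
  then show ?case using in_algebra_add[of X S "f i" "\<lambda>w. \<Sum>i\<in>A. f i w"] by simp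
qed (simp_all add: in_algebra_const)

section \<open>Contractions of indices as graphs with matrix-labelled edges\<close>

type_synonym ('w, 'k, 'v) edge = "('w \<Rightarrow> nat \<Rightarrow> nat \<Rightarrow> 'k) \<times> 'v \<times> 'v"

definition ends :: "('w, 'k, 'v) edge list \<Rightarrow> 'v list" where
  "ends es = concat (map (\<lambda>(A, u, v). [u, v]) es)"

definition edge_value :: "('w, 'k::comm_ring_1, 'v) edge list \<Rightarrow> 'w \<Rightarrow> ('v \<Rightarrow> nat) \<Rightarrow> 'k" where
  "edge_value es w I = prod_list (map (\<lambda>(A, u, v). A w (I u) (I v)) es)"

lemma ends_simps [simp]: "ends [] = []" "ends ((A, u, v) # es) = u # v # ends es"
  by (simp_all add: ends_def)

lemma edge_value_simps [simp]:
  "edge_value [] w I = 1" "edge_value ((A, u, v) # es) w I = A w (I u) (I v) * edge_value es w I"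
  by (simp_all add: edge_value_def)

lemma edge_value_upd [simp]: "z \<notin> set (ends es) \<Longrightarrow> edge_value es w (I(z := a)) = edge_value es w I"
  by (induction es) auto

text \<open>Alternating products Q R Q ... R Q, as functions of the point. They begin and end with a
  factor from \<open>\<Q>\<close>, so one factor from \<open>\<R>\<close> either glues two of them
  together or closes one to a cycle.\<close>

inductive_set chains :: "nat \<Rightarrow> ('w \<Rightarrow> nat \<Rightarrow> nat \<Rightarrow> 'k::comm_ring_1) set \<Rightarrow>
    ('w \<Rightarrow> nat \<Rightarrow> nat \<Rightarrow> 'k) set \<Rightarrow> ('w \<Rightarrow> nat \<Rightarrow> nat \<Rightarrow> 'k) set"
  for N :: nat and \<Q> \<R> :: "('w \<Rightarrow> nat \<Rightarrow> nat \<Rightarrow> 'k) set" where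
  base: "A \<in> \<Q> \<Longrightarrow> A \<in> chains N \<Q> \<R>"
| join: "A \<in> chains N \<Q> \<R> \<Longrightarrow> B \<in> \<R> \<Longrightarrow> A' \<in> chains N \<Q> \<R> \<Longrightarrow>
    (\<lambda>w a b. \<Sum>c<N. \<Sum>d<N. A w a c * B w c d * A' w d b) \<in> chains N \<Q> \<R>"

text \<open>Transposing a product of symmetric matrices reverses it, and a reversed alternating
  product is still alternating. Edges may therefore be turned around at will.\<close>

lemma chains_transpose:
  assumes "\<forall>A\<in>\<Q> \<union> \<R>. \<forall>w a b. A w a b = A w b a" and "A \<in> chains N \<Q> \<R>"
  shows "(\<lambda>w a b. A w b a) \<in> chains N \<Q> \<R>"
  using assms(2)
proof induction
  case (base A)
  then have "(\<lambda>w a b. A w b a) = A" using assms(1) by (fastforce simp: fun_eq_iff)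
  then show ?case using base by (simp add: chains.base)
next
  case (join A B A')
  have "(\<lambda>w a b. \<Sum>c<N. \<Sum>d<N. A' w c a * B w c d * A w b d) \<in> chains N \<Q> \<R>"
    using chains.join[OF join(5) join(2) join(4)] by simp
  also have "(\<lambda>w a b. \<Sum>c<N. \<Sum>d<N. A' w c a * B w c d * A w b d) =
      (\<lambda>w a b. \<Sum>d<N. \<Sum>c<N. A w b d * B w d c * A' w c a)"
  proof (intro ext)
    fix w a b
    have B: "B w c d = B w d c" for c d using assms(1) join(2) by blast
    show "(\<Sum>c<N. \<Sum>d<N. A' w c a * B w c d * A w b d) =
      (\<Sum>d<N. \<Sum>c<N. A w b d * B w d c * A' w c a)"
      by (subst sum.swap, intro sum.cong refl, subst B) (simp only: mult_ac)
  qed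
  finally show ?case .
qed

text \<open>Isolates an edge at \<open>x\<close> and orients it so that \<open>x\<close> is its
  second end, transposing the label if necessary. The multiset equation records which ends
  remain.\<close>

lemma extract_edge:
  fixes es :: "('w, 'k::comm_ring_1, 'v) edge list"
  assumes sym: "\<forall>A\<in>\<Q> \<union> \<R>. \<forall>w a b. A w a b = A w b a"
    and "x \<in> set (ends es)" "fst ` set es \<subseteq> chains N \<Q> \<R>"
  shows "\<exists>A u es'. A \<in> chains N \<Q> \<R> \<and> fst ` set es' \<subseteq> chains N \<Q> \<R> \<and>
    mset (ends es) = add_mset u (add_mset x (mset (ends es'))) \<and>
    (\<forall>w I. edge_value es w I = A w (I u) (I x) * edge_value es' w I)"
  using assms(2,3)
proof (induction es)
  case (Cons e es)
  obtain A u v where e: "e = (A, u, v)" by (cases e) auto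
  have A: "A \<in> chains N \<Q> \<R>" "fst ` set es \<subseteq> chains N \<Q> \<R>" using Cons(3) e by auto
  consider "x = v" | "x = u" | "x \<in> set (ends es)" using Cons(2) e by auto
  then show ?case
  proof cases
    case 1
    then show ?thesis using A by (intro exI[of _ A] exI[of _ u] exI[of _ es]) (simp add: e)
  next
    case 2
    then show ?thesis using A chains_transpose[OF sym A(1)]
      by (intro exI[of _ "\<lambda>w a b. A w b a"] exI[of _ v] exI[of _ es]) (simp add: e)
  next
    case 3
    from Cons.IH[OF this A(2)] obtain A' u' es' where IH: "A' \<in> chains N \<Q> \<R>"
      "fst ` set es' \<subseteq> chains N \<Q> \<R>"
      "mset (ends es) = add_mset u' (add_mset x (mset (ends es')))"
      "\<And>w I. edge_value es w I = A' w (I u') (I x) * edge_value es' w I" by blast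
    then show ?thesis using A
      by (intro exI[of _ A'] exI[of _ u'] exI[of _ "e # es'"]) (simp add: e mult_ac)
  qed
qed simp

lemma sum_words_insert:
  assumes "x \<notin> H"
  shows "(\<Sum>I\<in>words (insert x H) N. f I) = (\<Sum>I\<in>words H N. \<Sum>a<N. f (I(x := a)))"
proof -
  have "(\<Sum>I\<in>words (insert x H) N. f I) = (\<Sum>(a, I)\<in>{..<N} \<times> words H N. f (I(x := a)))"
    unfolding PiE_insert_eq
    by (subst sum.reindex[OF inj_combinator[OF assms]]) (simp add: case_prod_beta comp_def)
  also have "\<dots> = (\<Sum>I\<in>words H N. \<Sum>a<N. f (I(x := a)))"
    by (simp add: sum.cartesian_product[symmetric]) (rule sum.swap)
  finally show ?thesis .
qed

text \<open>The edges of the two lists are perfect matchings of the same set of indices; their union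
  is a disjoint union of alternating cycles, each contributing one trace.\<close>

lemma contraction_in_algebra:
  fixes Qs Rs :: "('w, 'k::field, 'v) edge list"
  assumes sym: "\<forall>A\<in>\<Q> \<union> \<R>. \<forall>w a b. A w a b = A w b a"
    and tr: "\<And>A B. A \<in> chains N \<Q> \<R> \<Longrightarrow> B \<in> \<R> \<Longrightarrow>
               in_algebra X S (\<lambda>w. \<Sum>a<N. \<Sum>b<N. A w a b * B w b a)"
    and "fst ` set Qs \<subseteq> chains N \<Q> \<R>" "fst ` set Rs \<subseteq> \<R>"
    and "distinct (ends Rs)" "mset (ends Qs) = mset (ends Rs)"
  shows "in_algebra X S (\<lambda>w. \<Sum>I\<in>words (set (ends Rs)) N. edge_value Qs w I * edge_value Rs w I)"
  using assms(3-)
proof (induction Rs arbitrary: Qs)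
  case Nil
  then have "Qs = []" by (cases Qs) auto
  then show ?case by (simp add: in_algebra_const)
next
  case (Cons e Rs)
  obtain B x y where e: "e = (B, x, y)" by (cases e) auto
  have B: "B \<in> \<R>" and R: "fst ` set Rs \<subseteq> \<R>" using Cons.prems(2) e by auto
  have xy: "x \<noteq> y" "x \<notin> set (ends Rs)" "y \<notin> set (ends Rs)" and dist: "distinct (ends Rs)"
    using Cons.prems(3) e by auto
  let ?H = "set (ends Rs)"
  have mQ: "mset (ends Qs) = add_mset x (add_mset y (mset (ends Rs)))" using Cons.prems(4) e by simp
  have "x \<in># mset (ends Qs)" unfolding mQ by simp
  then have "x \<in> set (ends Qs)" by simp
  from extract_edge[OF sym this Cons.prems(1)] obtain A u Qs' where A: "A \<in> chains N \<Q> \<R>"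
    and Q': "fst ` set Qs' \<subseteq> chains N \<Q> \<R>"
    and mQ': "mset (ends Qs) = add_mset u (add_mset x (mset (ends Qs')))"
    and vQ': "\<And>w I. edge_value Qs w I = A w (I u) (I x) * edge_value Qs' w I" by blast
  have m1: "add_mset u (mset (ends Qs')) = add_mset y (mset (ends Rs))"
    using mQ mQ' by (simp add: add_mset_commute)
  have split: "(\<Sum>I\<in>words (set (ends (e # Rs))) N. f I) =
      (\<Sum>I\<in>words ?H N. \<Sum>b<N. \<Sum>a<N. f (I(y := b, x := a)))" for f :: "_ \<Rightarrow> 'k"
    using xy by (simp add: e sum_words_insert)
  show ?case
  \<comment> \<open>The edge labelled \<open>B\<close> from \<open>x\<close> to \<open>y\<close> is
    removed. Either the other edge at \<open>x\<close> already ends in \<open>y\<close>, and a cycle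
    splits off as a factor, or the edges at \<open>x\<close> and \<open>y\<close> merge with
    \<open>B\<close> into one longer edge from \<open>u\<close> to \<open>v\<close>.\<close>
  proof (cases "u = y")
    case True
    then have m2: "mset (ends Qs') = mset (ends Rs)" using m1 by simp
    then have "set (ends Qs') = ?H" by (metis set_mset_mset)
    then have xyQ: "x \<notin> set (ends Qs')" "y \<notin> set (ends Qs')" using xy by auto
    have "in_algebra X S (\<lambda>w. (\<Sum>a<N. \<Sum>b<N. A w a b * B w b a) *
        (\<Sum>I\<in>words ?H N. edge_value Qs' w I * edge_value Rs w I))"
      by (intro in_algebra_mult tr A B Cons.IH Q' R dist m2)
    also have "(\<lambda>w. (\<Sum>a<N. \<Sum>b<N. A w a b * B w b a) *
        (\<Sum>I\<in>words ?H N. edge_value Qs' w I * edge_value Rs w I)) =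
      (\<lambda>w. \<Sum>I\<in>words (set (ends (e # Rs))) N. edge_value Qs w I * edge_value (e # Rs) w I)"
    proof (rule ext)
      fix w
      show "(\<Sum>a<N. \<Sum>b<N. A w a b * B w b a) *
        (\<Sum>I\<in>words ?H N. edge_value Qs' w I * edge_value Rs w I) =
        (\<Sum>I\<in>words (set (ends (e # Rs))) N. edge_value Qs w I * edge_value (e # Rs) w I)"
        unfolding split unfolding vQ' e edge_value_simps sum_distrib_left sum_distrib_right True
        using xy xyQ by (intro sum.cong refl) (simp add: mult_ac)
    qed
    finally show ?thesis .
  next
    case False
    have "y \<in># add_mset u (mset (ends Qs'))" unfolding m1 by simp
    then have "y \<in> set (ends Qs')" using False by simp
    from extract_edge[OF sym this Q'] obtain A' v Qs'' where A': "A' \<in> chains N \<Q> \<R>"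
      and Q'': "fst ` set Qs'' \<subseteq> chains N \<Q> \<R>"
      and mQ'': "mset (ends Qs') = add_mset v (add_mset y (mset (ends Qs'')))"
      and vQ'': "\<And>w I. edge_value Qs' w I = A' w (I v) (I y) * edge_value Qs'' w I" by blast
    \<comment> \<open>\<open>A'\<close> was extracted with \<open>y\<close> as its second end, so
      its transpose enters the product.\<close>
    define A2 where "A2 = (\<lambda>w a b. \<Sum>c<N. \<Sum>d<N. A w a c * B w c d * A' w b d)"
    have A2: "A2 \<in> chains N \<Q> \<R>"
      using chains.join[OF A B chains_transpose[OF sym A']] by (simp add: A2_def)
    have m2: "mset (ends ((A2, u, v) # Qs'')) = mset (ends Rs)"
      using m1 mQ'' by (simp add: add_mset_commute)
    then have "set (ends ((A2, u, v) # Qs'')) = ?H" by (metis set_mset_mset)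
    then have nn: "x \<notin> set (ends Qs'')" "y \<notin> set (ends Qs'')" "x \<noteq> u" "x \<noteq> v" "y \<noteq> u" "y \<noteq> v"
      using xy by auto
    have "in_algebra X S (\<lambda>w. \<Sum>I\<in>words ?H N. edge_value ((A2, u, v) # Qs'') w I * edge_value Rs w I)"
      by (rule Cons.IH[OF _ R dist m2]) (use A2 Q'' in auto)
    also have "(\<lambda>w. \<Sum>I\<in>words ?H N. edge_value ((A2, u, v) # Qs'') w I * edge_value Rs w I) =
      (\<lambda>w. \<Sum>I\<in>words (set (ends (e # Rs))) N. edge_value Qs w I * edge_value (e # Rs) w I)"
    proof (rule ext)
      fix w
      show "(\<Sum>I\<in>words ?H N. edge_value ((A2, u, v) # Qs'') w I * edge_value Rs w I) =
        (\<Sum>I\<in>words (set (ends (e # Rs))) N. edge_value Qs w I * edge_value (e # Rs) w I)"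
        unfolding split
      proof (rule sum.cong[OF refl])
        fix I
        have "edge_value ((A2, u, v) # Qs'') w I * edge_value Rs w I =
            (\<Sum>a<N. \<Sum>b<N. A w (I u) a * B w a b * A' w (I v) b * edge_value Qs'' w I * edge_value Rs w I)"
          by (simp add: A2_def sum_distrib_right)
        also have "\<dots> = (\<Sum>b<N. \<Sum>a<N. A w (I u) a * B w a b * A' w (I v) b * edge_value Qs'' w I * edge_value Rs w I)"
          by (rule sum.swap)
        also have "\<dots> = (\<Sum>b<N. \<Sum>a<N. edge_value Qs w (I(y := b, x := a)) * edge_value (e # Rs) w (I(y := b, x := a)))"
          unfolding vQ' vQ'' e edge_value_simps using xy nn
          by (intro sum.cong refl) (simp add: mult_ac)
        finally show "edge_value ((A2, u, v) # Qs'') w I * edge_value Rs w I =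
          (\<Sum>b<N. \<Sum>a<N. edge_value Qs w (I(y := b, x := a)) * edge_value (e # Rs) w (I(y := b, x := a)))" .
      qed
    qed
    finally show ?thesis .
  qed
qed

section \<open>Invariant multilinear forms\<close>

definition gl_act :: "nat \<Rightarrow> (nat \<Rightarrow> nat \<Rightarrow> 'k::comm_ring_1) \<Rightarrow> (nat \<Rightarrow> nat \<Rightarrow> 'k) \<Rightarrow> nat \<Rightarrow> nat \<Rightarrow> 'k" where
  "gl_act N g X a b = (\<Sum>p<N. \<Sum>q<N. g a p * X p q * g b q)"

definition gl_coact :: "nat \<Rightarrow> (nat \<Rightarrow> nat \<Rightarrow> 'k::comm_ring_1) \<Rightarrow> (nat \<Rightarrow> nat \<Rightarrow> 'k) \<Rightarrow> nat \<Rightarrow> nat \<Rightarrow> 'k" where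
  "gl_coact N g' X a b = (\<Sum>p<N. \<Sum>q<N. g' p a * X p q * g' q b)"

text \<open>Slot \<open>(h, False)\<close> carries the row index and \<open>(h, True)\<close> the
  column index of the \<open>h\<close>-th matrix. A word on these slots is a basis index of the
  \<open>2 * m\<close>-th tensor power, and permutations may mix rows with columns and different
  matrices.\<close>

abbreviation slots :: "nat \<Rightarrow> (nat \<times> bool) set" where
  "slots m \<equiv> {..<m} \<times> UNIV"

definition slot_prod :: "nat \<Rightarrow> (nat \<Rightarrow> nat \<Rightarrow> nat \<Rightarrow> 'k::comm_ring_1) \<Rightarrow> (nat \<times> bool \<Rightarrow> nat) \<Rightarrow> 'k" where
  "slot_prod m X I = (\<Prod>h<m. X h (I (h, False)) (I (h, True)))"

definition tensor_form :: "nat \<Rightarrow> nat \<Rightarrow> ((nat \<times> bool \<Rightarrow> nat) \<Rightarrow> (nat \<times> bool \<Rightarrow> nat) \<Rightarrow> 'k::comm_ring_1) \<Rightarrow>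
    (nat \<Rightarrow> nat \<Rightarrow> nat \<Rightarrow> 'k) \<Rightarrow> (nat \<Rightarrow> nat \<Rightarrow> nat \<Rightarrow> 'k) \<Rightarrow> 'k" where
  "tensor_form N m D X Y =
     (\<Sum>I\<in>words (slots m) N. \<Sum>J\<in>words (slots m) N. D I J * slot_prod m X I * slot_prod m Y J)"

lemma finite_slots: "finite (slots m)"
  by (simp add: finite_cartesian_product)

lemma prod_slots: "(\<Prod>k\<in>slots m. f k) = (\<Prod>h<m. f (h, False) * f (h, True))"
proof -
  have "(\<Prod>k\<in>slots m. f k) = (\<Prod>h<m. \<Prod>b\<in>UNIV. f (h, b))"
    by (simp add: prod.cartesian_product)
  also have "\<dots> = (\<Prod>h<m. f (h, False) * f (h, True))" by (simp add: UNIV_bool)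
  finally show ?thesis .
qed

lemma slot_in_words: "I \<in> words (slots m) N \<Longrightarrow> h < m \<Longrightarrow> I (h, b) < N"
  by (auto simp: PiE_iff)

lemma prod_sum_slots:
  "(\<Prod>k<m. \<Sum>p<N. \<Sum>q<N. f k p q) = (\<Sum>I\<in>words (slots m) N. slot_prod m f I)"
proof -
  have "(\<Prod>k<m. \<Sum>p<N. \<Sum>q<N. f k p q) = (\<Prod>k<m. \<Sum>z\<in>{..<N} \<times> {..<N}. f k (fst z) (snd z))"
    by (simp add: sum.cartesian_product case_prod_beta)
  also have "\<dots> = (\<Sum>u\<in>PiE {..<m} (\<lambda>_. {..<N} \<times> {..<N}). \<Prod>k<m. f k (fst (u k)) (snd (u k)))"
    by (rule prod_sum_PiE) auto
  also have "\<dots> = (\<Sum>I\<in>words (slots m) N. slot_prod m f I)"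
    unfolding slot_prod_def
    by (rule sum.reindex_bij_witness[of _ "\<lambda>I. \<lambda>k\<in>{..<m}. (I (k, False), I (k, True))"
          "\<lambda>u. \<lambda>k\<in>slots m. if snd k then snd (u (fst k)) else fst (u (fst k))"])
      (auto simp: PiE_iff fun_eq_iff extensional_def mem_Times_iff)
  finally show ?thesis .
qed

lemma slot_prod_elementary:
  assumes "I \<in> words (slots m) N" "I0 \<in> words (slots m) N"
  shows "slot_prod m (\<lambda>h a b. of_bool (a = I0 (h, False)) * of_bool (b = I0 (h, True))) I =
    (of_bool (I0 = I) :: 'k::field)"
proof -
  have "slot_prod m (\<lambda>h a b. of_bool (a = I0 (h, False)) * of_bool (b = I0 (h, True)) :: 'k) I =
      (\<Prod>k\<in>slots m. of_bool (I0 k = I k))"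
    unfolding prod_slots slot_prod_def by (simp only: eq_commute)
  then show ?thesis using prod_of_bool_eq[OF finite_slots assms(2,1), where 'k='k] by simp
qed

lemma gl_act_elementary:
  assumes "p0 < N" "q0 < N"
  shows "gl_act N g (\<lambda>a b. of_bool (a = p0) * of_bool (b = q0)) a b = g a p0 * g b q0"
proof -
  have "gl_act N g (\<lambda>a b. of_bool (a = p0) * of_bool (b = q0)) a b =
     (\<Sum>p<N. \<Sum>q<N. (g a p * g b q * of_bool (p0 = p)) * of_bool (q0 = q))"
    unfolding gl_act_def by (intro sum.cong refl) (auto simp: of_bool_def)
  then show ?thesis using assms by (simp only: sum_mult_of_bool finite_lessThan lessThan_iff if_True)
qed

lemma gl_coact_elementary:
  assumes "p0 < N" "q0 < N"
  shows "gl_coact N g (\<lambda>a b. of_bool (a = p0) * of_bool (b = q0)) a b = g p0 a * g q0 b"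
  using gl_act_elementary[OF assms, of "\<lambda>a b. g b a"] by (simp only: gl_act_def gl_coact_def)

text \<open>At elementary matrices invariance becomes an identity between entries of
  \<open>D\<close>, with the tensor power of \<open>g\<close> acting on one word and that of
  \<open>g'\<close> on the other. Multiplying by the tensor power of \<open>g\<close> cancels the
  one of \<open>g'\<close> and leaves a commutation relation for the transpose
  \<open>\<lambda>J I. D I J\<close>.\<close>

lemma invariant_tensor_form_coefficients:
  fixes D :: "(nat \<times> bool \<Rightarrow> nat) \<Rightarrow> (nat \<times> bool \<Rightarrow> nat) \<Rightarrow> 'k::field_char_0"
  assumes inv: "\<And>g g' X Y. inverse_pair N g g' \<Longrightarrow>
    tensor_form N m D (\<lambda>h. gl_act N g (X h)) (\<lambda>h. gl_coact N g' (Y h)) = tensor_form N m D X Y"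
  shows "\<exists>d. \<forall>I\<in>words (slots m) N. \<forall>J\<in>words (slots m) N.
    D I J = (\<Sum>s | s permutes slots m. \<Sum>t | t permutes slots m. d s t * of_bool (J \<circ> s = I \<circ> t))"
proof -
  let ?K = "slots m" and ?W = "words (slots m) N"
  have fW: "finite ?W" by (rule finite_words[OF finite_slots])
  define E where "E I h a b = (of_bool (a = I (h, False)) * of_bool (b = I (h, True)) :: 'k)"
    for I :: "nat \<times> bool \<Rightarrow> nat" and h a b
  have D_eq: "D I J = (\<Sum>I'\<in>?W. \<Sum>J'\<in>?W. D I' J' * tensor_power ?K g I' I * tensor_power ?K g' J J')"
    if g: "inverse_pair N g g'" and W: "I \<in> ?W" "J \<in> ?W" for g g' I J
  proof -
    have "D I J = (\<Sum>I'\<in>?W. \<Sum>J'\<in>?W. (D I' J' * of_bool (I = I')) * of_bool (J = J'))"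
      using W by (simp only: sum_mult_of_bool fW if_True)
    also have "\<dots> = tensor_form N m D (E I) (E J)"
      unfolding tensor_form_def E_def
      by (intro sum.cong refl) (simp only: slot_prod_elementary[OF _ W(1)] slot_prod_elementary[OF _ W(2)])
    also have "\<dots> = tensor_form N m D (\<lambda>h. gl_act N g (E I h)) (\<lambda>h. gl_coact N g' (E J h))"
      by (rule inv[OF g, symmetric])
    also have "\<dots> = (\<Sum>I'\<in>?W. \<Sum>J'\<in>?W. D I' J' * tensor_power ?K g I' I * tensor_power ?K g' J J')"
    proof -
      have "slot_prod m (\<lambda>h. gl_act N g (E I h)) I' = tensor_power ?K g I' I" for I'
        unfolding tensor_power_def prod_slots slot_prod_def E_def
        by (intro prod.cong refl gl_act_elementary slot_in_words[OF W(1)]) auto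
      moreover have "slot_prod m (\<lambda>h. gl_coact N g' (E J h)) J' = tensor_power ?K g' J J'" for J'
        unfolding tensor_power_def prod_slots slot_prod_def E_def
        by (intro prod.cong refl gl_coact_elementary slot_in_words[OF W(2)]) auto
      ultimately show ?thesis by (simp only: tensor_form_def)
    qed
    finally show ?thesis .
  qed
  have tp: "(\<Sum>J\<in>?W. tensor_power ?K g L J * tensor_power ?K g' J J') = of_bool (L = J')"
    if g: "inverse_pair N g g'" and W: "L \<in> ?W" "J' \<in> ?W" for g g' L J'
  proof -
    have "(\<Sum>J\<in>?W. tensor_power ?K g L J * tensor_power ?K g' J J') =
        (\<Sum>J\<in>?W. \<Prod>h\<in>?K. g (L h) (J h) * g' (J h) (J' h))"
      unfolding tensor_power_def by (simp only: prod.distrib)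
    also have "\<dots> = (\<Prod>h\<in>?K. \<Sum>c<N. g (L h) c * g' c (J' h))"
      by (rule prod_sum_PiE[symmetric]) (simp_all only: finite_slots finite_lessThan)
    also have "\<dots> = (\<Prod>h\<in>?K. of_bool (L h = J' h))"
    proof (rule prod.cong[OF refl])
      fix h assume h: "h \<in> ?K"
      have "L h < N" "J' h < N" using W PiE_mem[OF _ h] by blast+
      then show "(\<Sum>c<N. g (L h) c * g' c (J' h)) = of_bool (L h = J' h)"
        using g unfolding inverse_pair_def by blast
    qed
    also have "\<dots> = of_bool (L = J')" by (rule prod_of_bool_eq[OF finite_slots W])
    finally show ?thesis .
  qed
  have "commutes_on ?W (\<lambda>J I. D I J) (tensor_power ?K g)" if g: "inverse_pair N g g'" for g g'
    unfolding commutes_on_def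
  proof (intro ballI)
    fix L I assume W: "L \<in> ?W" "I \<in> ?W"
    have "(\<Sum>J\<in>?W. tensor_power ?K g L J * D I J) =
      (\<Sum>J\<in>?W. \<Sum>I'\<in>?W. \<Sum>J'\<in>?W. D I' J' * tensor_power ?K g I' I *
         (tensor_power ?K g L J * tensor_power ?K g' J J'))"
      by (intro sum.cong refl, subst D_eq[OF g W(2)], assumption) (simp only: sum_distrib_left mult_ac)
    also have "\<dots> = (\<Sum>I'\<in>?W. \<Sum>J'\<in>?W. D I' J' * tensor_power ?K g I' I *
         (\<Sum>J\<in>?W. tensor_power ?K g L J * tensor_power ?K g' J J'))"
      unfolding sum_distrib_left by (rule sum_swap_outer[symmetric])
    also have "\<dots> = (\<Sum>I'\<in>?W. \<Sum>J'\<in>?W. D I' J' * tensor_power ?K g I' I * of_bool (L = J'))"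
      using tp[OF g W(1)] by (intro sum.cong refl) simp
    also have "\<dots> = (\<Sum>I'\<in>?W. D I' L * tensor_power ?K g I' I)"
      using W by (simp only: sum_mult_of_bool fW if_True)
    finally show "(\<Sum>J\<in>?W. tensor_power ?K g L J * D I J) =
      (\<Sum>I'\<in>?W. D I' L * tensor_power ?K g I' I)" .
  qed
  from commutant_of_tensor_powers[OF finite_slots this] obtain d where
    "\<forall>I\<in>?W. \<forall>J\<in>?W.
      D J I = (\<Sum>s | s permutes ?K. \<Sum>t | t permutes ?K. d s t * of_bool (I \<circ> s = J \<circ> t))" by (rule exE)
  then show ?thesis by (intro exI[of _ d] ballI) (simp only:)
qed

text \<open>Replacing \<open>I\<close> by \<open>I \<circ> inv t\<close> and \<open>J\<close> by
  \<open>J \<circ> inv s\<close> turns the condition into \<open>J = I\<close>, which collapses the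
  double sum.\<close>

lemma sum_words_of_bool_permuted:
  fixes F G :: "('h \<Rightarrow> nat) \<Rightarrow> 'k::comm_ring_1"
  assumes "finite H" "s permutes H" "t permutes H"
  shows "(\<Sum>I\<in>words H N. \<Sum>J\<in>words H N. of_bool (J \<circ> s = I \<circ> t) * F I * G J) =
    (\<Sum>I\<in>words H N. F (I \<circ> Hilbert_Choice.inv t) * G (I \<circ> Hilbert_Choice.inv s))"
proof -
  let ?W = "words H N" and ?s = "Hilbert_Choice.inv s" and ?t = "Hilbert_Choice.inv t"
  have st: "?s permutes H" "?t permutes H" using assms permutes_inv by auto
  have "(\<Sum>I\<in>?W. \<Sum>J\<in>?W. of_bool (J \<circ> s = I \<circ> t) * F I * G J) =
      (\<Sum>I\<in>?W. \<Sum>J\<in>?W. of_bool (J \<circ> s = (I \<circ> ?t) \<circ> t) * F (I \<circ> ?t) * G J)"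
    by (rule sum_PiE_permute[OF st(2), symmetric])
  also have "\<dots> = (\<Sum>I\<in>?W. \<Sum>J\<in>?W. of_bool ((J \<circ> ?s) \<circ> s = (I \<circ> ?t) \<circ> t) * F (I \<circ> ?t) * G (J \<circ> ?s))"
    by (rule sum.cong[OF refl], rule sum_PiE_permute[OF st(1), symmetric])
  also have "\<dots> = (\<Sum>I\<in>?W. \<Sum>J\<in>?W. F (I \<circ> ?t) * G (J \<circ> ?s) * of_bool (I = J))"
    unfolding comp_assoc permutes_inv_o(2)[OF assms(2)] permutes_inv_o(2)[OF assms(3)] comp_id
    by (intro sum.cong refl) (simp only: mult_ac eq_commute)
  also have "\<dots> = (\<Sum>I\<in>?W. F (I \<circ> ?t) * G (I \<circ> ?s))"
    by (intro sum.cong refl) (simp only: sum_mult_of_bool finite_words[OF assms(1)] if_True)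
  finally show ?thesis .
qed

text \<open>For a permutation \<open>p\<close> the edges form a perfect matching of
  \<open>slots m\<close>: each matrix joins the images of its two slots.\<close>

definition slot_edges :: "nat \<Rightarrow> (nat \<Rightarrow> 'w \<Rightarrow> nat \<Rightarrow> nat \<Rightarrow> 'k) \<Rightarrow> (nat \<times> bool \<Rightarrow> nat \<times> bool) \<Rightarrow>
    ('w, 'k, nat \<times> bool) edge list" where
  "slot_edges m X p = map (\<lambda>h. (X h, p (h, False), p (h, True))) [0..<m]"

lemma slot_edges_value: "edge_value (slot_edges m X p) w I = slot_prod m (\<lambda>h. X h w) (I \<circ> p)"
proof -
  have "edge_value (slot_edges m X p) w I =
      prod_list (map (\<lambda>h. X h w (I (p (h, False))) (I (p (h, True)))) [0..<m])"
    by (simp add: edge_value_def slot_edges_def comp_def)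
  also have "\<dots> = prod (\<lambda>h. X h w (I (p (h, False))) (I (p (h, True)))) (set [0..<m])"
    by (rule prod.distinct_set_conv_list[symmetric]) simp
  finally show ?thesis by (simp add: slot_prod_def atLeast0LessThan)
qed

lemma slot_edges_ends:
  assumes "p permutes slots m"
  shows "distinct (ends (slot_edges m X p))" "set (ends (slot_edges m X p)) = slots m"
proof -
  define ks where "ks = concat (map (\<lambda>h. [(h, False), (h, True)]) [0..<m])"
  have e: "ends (slot_edges m X p) = map p ks"
    by (simp add: ends_def slot_edges_def ks_def map_concat comp_def)
  have ks: "set ks = slots m" by (auto simp: ks_def)
  have "distinct ks" unfolding ks_def by (induction m) auto
  moreover have "inj_on p (set ks)" using permutes_inj[OF assms] by (auto intro: inj_on_subset)
  ultimately show "distinct (ends (slot_edges m X p))" by (simp add: e distinct_map)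
  show "set (ends (slot_edges m X p)) = slots m"
    using permutes_image[OF assms] by (simp add: e ks)
qed

text \<open>Expanding \<open>D\<close> in pairs of permutations makes every summand a contraction of
  two perfect matchings of the same slots. Invariance is assumed at arbitrary matrices, since
  \<open>D\<close> is determined there; symmetry of the inserted matrices serves to cut the
  contraction into cycles.\<close>

theorem invariant_tensor_form_in_algebra:
  fixes D :: "(nat \<times> bool \<Rightarrow> nat) \<Rightarrow> (nat \<times> bool \<Rightarrow> nat) \<Rightarrow> 'k::field_char_0"
  assumes inv: "\<And>g g' X Y. inverse_pair N g g' \<Longrightarrow>
      tensor_form N m D (\<lambda>h. gl_act N g (X h)) (\<lambda>h. gl_coact N g' (Y h)) = tensor_form N m D X Y"
    and sym: "\<forall>A\<in>\<Q> \<union> \<R>. \<forall>w a b. A w a b = A w b a"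
    and tr: "\<And>A B. A \<in> chains N \<Q> \<R> \<Longrightarrow> B \<in> \<R> \<Longrightarrow>
               in_algebra Z S (\<lambda>w. \<Sum>a<N. \<Sum>b<N. A w a b * B w b a)"
    and X: "\<And>h. h < m \<Longrightarrow> X h \<in> \<Q>" and Y: "\<And>h. h < m \<Longrightarrow> Y h \<in> \<R>"
  shows "in_algebra Z S (\<lambda>w. tensor_form N m D (\<lambda>h. X h w) (\<lambda>h. Y h w))"
proof -
  let ?K = "slots m" and ?W = "words (slots m) N"
  let ?P = "{s. s permutes slots m}"
  obtain d where d: "\<And>I J. I \<in> ?W \<Longrightarrow> J \<in> ?W \<Longrightarrow>
      D I J = (\<Sum>s\<in>?P. \<Sum>t\<in>?P. d s t * of_bool (J \<circ> s = I \<circ> t))"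
    using invariant_tensor_form_coefficients[OF inv] by blast
  have "in_algebra Z S (\<lambda>w. \<Sum>s\<in>?P. \<Sum>t\<in>?P. d s t *
      (\<Sum>I\<in>?W. edge_value (slot_edges m X (Hilbert_Choice.inv t)) w I *
               edge_value (slot_edges m Y (Hilbert_Choice.inv s)) w I))"
  proof (rule in_algebra_sum, rule in_algebra_sum, rule in_algebra_mult[OF in_algebra_const])
    fix s t assume "s \<in> ?P" "t \<in> ?P"
    then have p: "Hilbert_Choice.inv s permutes ?K" "Hilbert_Choice.inv t permutes ?K"
      using permutes_inv by auto
    note s = slot_edges_ends[OF p(1), of Y] and t = slot_edges_ends[OF p(2), of X]
    have "in_algebra Z S (\<lambda>w. \<Sum>I\<in>words (set (ends (slot_edges m Y (Hilbert_Choice.inv s)))) N.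
        edge_value (slot_edges m X (Hilbert_Choice.inv t)) w I *
        edge_value (slot_edges m Y (Hilbert_Choice.inv s)) w I)"
    proof (rule contraction_in_algebra[OF sym tr])
      show "fst ` set (slot_edges m X (Hilbert_Choice.inv t)) \<subseteq> chains N \<Q> \<R>"
        using X by (auto simp: slot_edges_def intro: chains.base)
      show "fst ` set (slot_edges m Y (Hilbert_Choice.inv s)) \<subseteq> \<R>"
        using Y by (auto simp: slot_edges_def)
      show "mset (ends (slot_edges m X (Hilbert_Choice.inv t))) =
          mset (ends (slot_edges m Y (Hilbert_Choice.inv s)))"
        using set_eq_iff_mset_eq_distinct[OF t(1) s(1)] s(2) t(2) by simp
    qed (use s in auto)
    then show "in_algebra Z S (\<lambda>w. \<Sum>I\<in>?W. edge_value (slot_edges m X (Hilbert_Choice.inv t)) w I *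
        edge_value (slot_edges m Y (Hilbert_Choice.inv s)) w I)" unfolding s(2) .
  qed
  also have "(\<lambda>w. \<Sum>s\<in>?P. \<Sum>t\<in>?P. d s t *
      (\<Sum>I\<in>?W. edge_value (slot_edges m X (Hilbert_Choice.inv t)) w I *
               edge_value (slot_edges m Y (Hilbert_Choice.inv s)) w I)) =
    (\<lambda>w. tensor_form N m D (\<lambda>h. X h w) (\<lambda>h. Y h w))"
  proof (rule ext)
    fix w
    let ?F = "slot_prod m (\<lambda>h. X h w)" and ?G = "slot_prod m (\<lambda>h. Y h w)"
    have "tensor_form N m D (\<lambda>h. X h w) (\<lambda>h. Y h w) =
        (\<Sum>I\<in>?W. \<Sum>J\<in>?W. \<Sum>s\<in>?P. \<Sum>t\<in>?P. d s t * (of_bool (J \<circ> s = I \<circ> t) * ?F I * ?G J))"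
      unfolding tensor_form_def
      by (rule sum.cong[OF refl], rule sum.cong[OF refl])
        (simp only: d sum_distrib_right mult.assoc)
    also have "\<dots> = (\<Sum>s\<in>?P. \<Sum>I\<in>?W. \<Sum>J\<in>?W. \<Sum>t\<in>?P. d s t * (of_bool (J \<circ> s = I \<circ> t) * ?F I * ?G J))"
      by (rule sum_swap_outer)
    also have "\<dots> = (\<Sum>s\<in>?P. \<Sum>t\<in>?P. \<Sum>I\<in>?W. \<Sum>J\<in>?W. d s t * (of_bool (J \<circ> s = I \<circ> t) * ?F I * ?G J))"
      by (rule sum.cong[OF refl], rule sum_swap_outer)
    also have "\<dots> = (\<Sum>s\<in>?P. \<Sum>t\<in>?P. d s t *
      (\<Sum>I\<in>?W. edge_value (slot_edges m X (Hilbert_Choice.inv t)) w I *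
               edge_value (slot_edges m Y (Hilbert_Choice.inv s)) w I))"
      unfolding sum_distrib_left[symmetric] slot_edges_value
      by (intro sum.cong refl arg_cong2[where f="(*)"] sum_words_of_bool_permuted finite_slots)
         simp_all
    finally show "(\<Sum>s\<in>?P. \<Sum>t\<in>?P. d s t *
      (\<Sum>I\<in>?W. edge_value (slot_edges m X (Hilbert_Choice.inv t)) w I *
               edge_value (slot_edges m Y (Hilbert_Choice.inv s)) w I)) =
      tensor_form N m D (\<lambda>h. X h w) (\<lambda>h. Y h w)" by (rule HOL.sym)
  qed
  finally show ?thesis .
qed

section \<open>Invariant polynomials\<close>

text \<open>A term \<open>(c, us, vs)\<close> stands for \<open>c\<close> times the product of the coordinates \<open>us\<close> of the first
  tuple of matrices and the coordinates \<open>vs\<close> of the second; a coordinate \<open>(i, a, b)\<close> is the entry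
  \<open>(a, b)\<close> of the \<open>i\<close>-th matrix.\<close>

type_synonym 'k mat_family = "nat \<Rightarrow> nat \<Rightarrow> nat \<Rightarrow> 'k"
type_synonym coordinate = "nat \<times> nat \<times> nat"
type_synonym 'k poly_term = "'k \<times> coordinate list \<times> coordinate list"

definition coord :: "'k mat_family \<Rightarrow> coordinate \<Rightarrow> 'k" where
  "coord x u = (case u of (i, a, b) \<Rightarrow> x i a b)"

definition mono_value :: "coordinate list \<Rightarrow> 'k::comm_ring_1 mat_family \<Rightarrow> 'k" where
  "mono_value us x = prod_list (map (coord x) us)"

definition poly_value :: "'k::comm_ring_1 poly_term list \<Rightarrow> 'k mat_family \<Rightarrow> 'k mat_family \<Rightarrow> 'k" where
  "poly_value L x y = sum_list (map (\<lambda>(c, us, vs). c * mono_value us x * mono_value vs y) L)"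

definition valid_coords :: "nat \<Rightarrow> nat \<Rightarrow> coordinate list \<Rightarrow> bool" where
  "valid_coords N d us \<longleftrightarrow> set us \<subseteq> {1..d} \<times> {..<N} \<times> {..<N}"

definition valid_terms :: "nat \<Rightarrow> nat \<Rightarrow> nat \<Rightarrow> 'k poly_term list \<Rightarrow> bool" where
  "valid_terms N d1 d2 L \<longleftrightarrow> (\<forall>(c, us, vs)\<in>set L. valid_coords N d1 us \<and> valid_coords N d2 vs)"

definition symmetric_family :: "'k mat_family \<Rightarrow> bool" where
  "symmetric_family x \<longleftrightarrow> (\<forall>i a b. x i a b = x i b a)"

text \<open>Restricted to symmetric families because \<open>(i, a, b)\<close> and
  \<open>(i, b, a)\<close> are different coordinates in a term but the same function on symmetric
  matrices: at other families, terms that represent an invariant function need not be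
  invariant.\<close>

definition invariant_terms :: "nat \<Rightarrow> 'k::field poly_term list \<Rightarrow> bool" where
  "invariant_terms N L \<longleftrightarrow> (\<forall>g g' x y. inverse_pair N g g' \<longrightarrow> symmetric_family x \<longrightarrow> symmetric_family y \<longrightarrow>
     poly_value L (\<lambda>i. gl_act N g (x i)) (\<lambda>j. gl_coact N g' (y j)) = poly_value L x y)"

definition component :: "nat \<Rightarrow> nat \<Rightarrow> 'k poly_term list \<Rightarrow> 'k poly_term list" where
  "component p q L = filter (\<lambda>(c, us, vs). length us = p \<and> length vs = q) L"

lemma poly_value_simps [simp]:
  "poly_value [] x y = 0"
  "poly_value ((c, us, vs) # L) x y = c * mono_value us x * mono_value vs y + poly_value L x y"
  by (simp_all add: poly_value_def)

lemma valid_terms_Cons [simp]: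
  "valid_terms N d1 d2 ((c, us, vs) # L) \<longleftrightarrow>
     valid_coords N d1 us \<and> valid_coords N d2 vs \<and> valid_terms N d1 d2 L"
  by (simp add: valid_terms_def)

lemma mono_value_conv_prod: "mono_value us x = (\<Prod>h<length us. coord x (us ! h))"
  by (simp add: mono_value_def prod.list_conv_set_nth atLeast0LessThan)

lemma mono_value_scale: "mono_value us (\<lambda>i a b. s * x i a b) = s ^ length us * mono_value us x"
  by (induction us) (auto simp: mono_value_def coord_def mult_ac)

lemma mono_value_cong:
  assumes "valid_coords N d us" "\<And>i a b. i \<in> {1..d} \<Longrightarrow> a < N \<Longrightarrow> b < N \<Longrightarrow> x i a b = y i a b"
  shows "mono_value us x = mono_value us y"
proof -
  have "map (coord x) us = map (coord y) us"
    using assms by (intro map_cong refl) (force simp: valid_coords_def coord_def)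
  then show ?thesis by (simp only: mono_value_def)
qed

lemma poly_value_cong:
  assumes "valid_terms N d1 d2 L"
    and "\<And>i a b. i \<in> {1..d1} \<Longrightarrow> a < N \<Longrightarrow> b < N \<Longrightarrow> x i a b = x' i a b"
    and "\<And>i a b. i \<in> {1..d2} \<Longrightarrow> a < N \<Longrightarrow> b < N \<Longrightarrow> y i a b = y' i a b"
  shows "poly_value L x y = poly_value L x' y'"
  using assms(1)
proof (induction L)
  case (Cons e L)
  obtain c us vs where e: "e = (c, us, vs)" by (cases e) auto
  have "mono_value us x = mono_value us x'" "mono_value vs y = mono_value vs y'"
    using Cons.prems assms(2,3) by (auto simp: e intro: mono_value_cong)
  then show ?case using Cons by (simp add: e)
qed simp

section \<open>Bihomogeneous components and scaling\<close>

lemma poly_value_components: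
  assumes "\<forall>(c, us, vs)\<in>set L. length us \<le> d \<and> length vs \<le> d"
  shows "poly_value L (\<lambda>i a b. s * x i a b) (\<lambda>i a b. t * y i a b) =
    (\<Sum>p\<le>d. s ^ p * (\<Sum>q\<le>d. t ^ q * poly_value (component p q L) x y))"
  using assms
proof (induction L)
  case (Cons e L)
  obtain c us vs where e: "e = (c, us, vs)" by (cases e) auto
  let ?v = "c * mono_value us x * mono_value vs y"
  have len: "length us \<le> d" "length vs \<le> d" using Cons.prems by (auto simp: e)
  have *: "poly_value (component p q (e # L)) x y =
      ?v * of_bool (length vs = q) * of_bool (length us = p) + poly_value (component p q L) x y" for p q
    by (auto simp: component_def e)
  have "(\<Sum>p\<le>d. s ^ p * (\<Sum>q\<le>d. t ^ q * poly_value (component p q (e # L)) x y)) =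
      (\<Sum>p\<le>d. (\<Sum>q\<le>d. s ^ p * t ^ q * ?v * of_bool (length vs = q)) * of_bool (length us = p)) +
      (\<Sum>p\<le>d. s ^ p * (\<Sum>q\<le>d. t ^ q * poly_value (component p q L) x y))"
    unfolding * by (simp only: ring_distribs sum.distrib sum_distrib_left sum_distrib_right mult_ac)
  also have "(\<Sum>p\<le>d. (\<Sum>q\<le>d. s ^ p * t ^ q * ?v * of_bool (length vs = q)) * of_bool (length us = p)) =
      s ^ length us * t ^ length vs * ?v"
    using len by (simp only: sum_mult_of_bool finite_atMost atMost_iff if_True)
  finally show ?case using Cons by (simp add: e mono_value_scale mult_ac)
qed (simp add: component_def)

lemma poly_value_scale:
  assumes "\<forall>(c, us, vs)\<in>set L. length us = p \<and> length vs = q"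
  shows "poly_value L (\<lambda>i a b. s * x i a b) (\<lambda>i a b. t * y i a b) = s ^ p * t ^ q * poly_value L x y"
  using assms by (induction L) (auto simp: mono_value_scale algebra_simps)

lemma polynomial_coefficients_eq:
  fixes a b :: "nat \<Rightarrow> 'k::{idom, ring_char_0}"
  assumes "\<And>t. (\<Sum>p\<le>d. t ^ p * a p) = (\<Sum>p\<le>d. t ^ p * b p)" and "p \<le> d"
  shows "a p = b p"
proof -
  define P where "P = (\<Sum>p\<le>d. monom (a p - b p) p)"
  have "poly P t = 0" for t
    using assms(1)[of t] by (simp add: P_def poly_sum poly_monom ring_distribs sum_subtractf mult.commute)
  then have "P = 0" using poly_all_0_iff_0 by blast
  then have "coeff P p = 0" by simp
  then show ?thesis using assms(2) by (simp add: P_def coeff_sum)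
qed

lemma gl_act_scale: "gl_act N g (\<lambda>a b. s * X a b) = (\<lambda>a b. s * gl_act N g X a b)"
  by (simp add: gl_act_def fun_eq_iff sum_distrib_left mult_ac)

lemma gl_coact_scale: "gl_coact N g (\<lambda>a b. s * X a b) = (\<lambda>a b. s * gl_coact N g X a b)"
  by (simp add: gl_coact_def fun_eq_iff sum_distrib_left mult_ac)

lemma gl_act_sum: "gl_act N g (\<lambda>a b. \<Sum>k\<in>S. X k a b) = (\<lambda>a b. \<Sum>k\<in>S. gl_act N g (X k) a b)"
  unfolding gl_act_def fun_eq_iff sum_distrib_left sum_distrib_right
  by (intro allI) (rule sum_swap_outer)

lemma gl_coact_sum: "gl_coact N g (\<lambda>a b. \<Sum>k\<in>S. X k a b) = (\<lambda>a b. \<Sum>k\<in>S. gl_coact N g (X k) a b)"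
  unfolding gl_coact_def fun_eq_iff sum_distrib_left sum_distrib_right
  by (intro allI) (rule sum_swap_outer)

text \<open>The action is linear in each matrix, so it commutes with scaling the two tuples by
  independent parameters \<open>s\<close> and \<open>t\<close>. Comparing coefficients, in
  \<open>s\<close> and then in \<open>t\<close>, isolates one bidegree.\<close>

lemma invariant_component:
  fixes L :: "'k::field_char_0 poly_term list"
  assumes "invariant_terms N L"
  shows "invariant_terms N (component p q L)"
  unfolding invariant_terms_def
proof (intro allI impI)
  fix g g' :: "nat \<Rightarrow> nat \<Rightarrow> 'k" and x y :: "'k mat_family"
  assume g: "inverse_pair N g g'" and xy: "symmetric_family x" "symmetric_family y"
  \<comment> \<open>The summand \<open>p + q\<close> puts both degrees into the range of summation
    even if \<open>L\<close> has no term of this bidegree.\<close>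
  define d where "d = p + q + sum_list (map (\<lambda>(c, us, vs). length us + length vs) L)"
  have d: "p \<le> d" "q \<le> d" "\<forall>(c, us, vs)\<in>set L. length us \<le> d \<and> length vs \<le> d"
  proof -
    have "length us + length vs \<le> sum_list (map (\<lambda>(c, us, vs). length us + length vs) L)"
      if "(c, us, vs) \<in> set L" for c us vs
      using that by (intro member_le_sum_list; force)
    then show "\<forall>(c, us, vs)\<in>set L. length us \<le> d \<and> length vs \<le> d" unfolding d_def by fastforce
  qed (simp_all add: d_def)
  let ?x = "\<lambda>i. gl_act N g (x i)" and ?y = "\<lambda>j. gl_coact N g' (y j)"
  have "(\<Sum>p\<le>d. s ^ p * (\<Sum>q\<le>d. t ^ q * poly_value (component p q L) ?x ?y)) =
      (\<Sum>p\<le>d. s ^ p * (\<Sum>q\<le>d. t ^ q * poly_value (component p q L) x y))" for s t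
  proof -
    have "symmetric_family (\<lambda>i a b. s * x i a b)" "symmetric_family (\<lambda>i a b. t * y i a b)"
      using xy unfolding symmetric_family_def by metis+
    then have "poly_value L (\<lambda>i. gl_act N g (\<lambda>a b. s * x i a b)) (\<lambda>j. gl_coact N g' (\<lambda>a b. t * y j a b)) =
        poly_value L (\<lambda>i a b. s * x i a b) (\<lambda>j a b. t * y j a b)"
      using assms g unfolding invariant_terms_def by blast
    then show ?thesis
      by (simp only: gl_act_scale gl_coact_scale poly_value_components[OF d(3)])
  qed
  from polynomial_coefficients_eq[OF this d(1)]
  have "(\<Sum>q\<le>d. t ^ q * poly_value (component p q L) ?x ?y) =
      (\<Sum>q\<le>d. t ^ q * poly_value (component p q L) x y)" for t .
  from polynomial_coefficients_eq[OF this d(2)]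
  show "poly_value (component p q L) ?x ?y = poly_value (component p q L) x y" .
qed

lemma valid_component: "valid_terms N d1 d2 L \<Longrightarrow> valid_terms N d1 d2 (component p q L)"
  by (auto simp: valid_terms_def component_def)

lemma gl_act_scalar:
  assumes "a < N" "b < N"
  shows "gl_act N (\<lambda>a b. r * of_bool (a = b)) X a b = r ^ 2 * X a b"
proof -
  have "gl_act N (\<lambda>a b. r * of_bool (a = b)) X a b =
      (\<Sum>p<N. (\<Sum>q<N. r ^ 2 * X p q * of_bool (b = q)) * of_bool (a = p))"
    unfolding gl_act_def sum_distrib_right
    by (intro sum.cong refl) (auto simp: of_bool_def power2_eq_square)
  then show ?thesis using assms by (simp only: sum_mult_of_bool finite_lessThan lessThan_iff if_True)
qed

lemma gl_coact_scalar:
  assumes "a < N" "b < N"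
  shows "gl_coact N (\<lambda>a b. r * of_bool (a = b)) X a b = r ^ 2 * X a b"
proof -
  have "gl_coact N (\<lambda>a b. r * of_bool (a = b)) X a b = gl_act N (\<lambda>a b. r * of_bool (a = b)) X a b"
    unfolding gl_act_def gl_coact_def by (simp only: eq_commute)
  then show ?thesis using gl_act_scalar[OF assms] by simp
qed

lemma unbalanced_component_zero:
  fixes L :: "'k::field_char_0 poly_term list"
  assumes "valid_terms N d1 d2 L" "invariant_terms N L" "p \<noteq> q"
    and xy: "symmetric_family x" "symmetric_family y"
  shows "poly_value (component p q L) x y = 0"
proof -
  let ?L = "component p q L"
  let ?g = "\<lambda>a b. 2 * of_bool (a = b) :: 'k" and ?g' = "\<lambda>a b. (1 / 2) * of_bool (a = b) :: 'k"
  have "(\<Sum>c<N. ?g a c * ?g' c b) = of_bool (a = b) \<and> (\<Sum>c<N. ?g' a c * ?g c b) = of_bool (a = b)"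
    if "a < N" "b < N" for a b
  proof -
    have "(\<Sum>c<N. ?g a c * ?g' c b) = (\<Sum>c<N. of_bool (c = b) * of_bool (a = c))"
      "(\<Sum>c<N. ?g' a c * ?g c b) = (\<Sum>c<N. of_bool (c = b) * of_bool (a = c))"
      by (intro sum.cong refl; simp add: of_bool_def)+
    then show ?thesis using that by (simp only: sum_mult_of_bool finite_lessThan lessThan_iff if_True simp_thms)
  qed
  then have "inverse_pair N ?g ?g'" unfolding inverse_pair_def by blast
  then have "poly_value ?L x y = poly_value ?L (\<lambda>i. gl_act N ?g (x i)) (\<lambda>j. gl_coact N ?g' (y j))"
    using invariant_component[OF assms(2), of p q] xy unfolding invariant_terms_def by metis
  also have "\<dots> = poly_value ?L (\<lambda>i a b. 2 ^ 2 * x i a b) (\<lambda>i a b. (1 / 2) ^ 2 * y i a b)"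
    by (rule poly_value_cong[OF valid_component[OF assms(1)]]) (simp_all only: gl_act_scalar gl_coact_scalar)
  also have "\<dots> = 4 ^ p * (1 / 4) ^ q * poly_value ?L x y"
    by (subst poly_value_scale[of _ p q]) (auto simp: component_def power2_eq_square)
  finally have "(4 ^ q - 4 ^ p) * poly_value ?L x y = 0"
    by (simp add: field_simps)
  moreover have "(4::'k) ^ q \<noteq> 4 ^ p"
  proof -
    have "of_nat (4 ^ q) \<noteq> (of_nat (4 ^ p) :: 'k)" using assms(3) by (simp only: of_nat_eq_iff) simp
    then show ?thesis by simp
  qed
  ultimately show ?thesis by simp
qed

section \<open>Full polarization of a balanced component\<close>

definition polar :: "nat \<Rightarrow> coordinate list \<Rightarrow> (nat \<Rightarrow> 'k::comm_ring_1 mat_family) \<Rightarrow> 'k" where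
  "polar m us xs = (\<Sum>p | p permutes {..<m}. \<Prod>h<m. coord (xs (p h)) (us ! h))"

definition polar_value :: "nat \<Rightarrow> 'k::comm_ring_1 poly_term list \<Rightarrow>
    (nat \<Rightarrow> 'k mat_family) \<Rightarrow> (nat \<Rightarrow> 'k mat_family) \<Rightarrow> 'k" where
  "polar_value m L xs ys = sum_list (map (\<lambda>(c, us, vs). c * polar m us xs * polar m vs ys) L)"

definition balanced :: "nat \<Rightarrow> 'k poly_term list \<Rightarrow> bool" where
  "balanced m L \<longleftrightarrow> (\<forall>(c, us, vs)\<in>set L. length us = m \<and> length vs = m)"

lemma balanced_Cons [simp]:
  "balanced m ((c, us, vs) # L) \<longleftrightarrow> length us = m \<and> length vs = m \<and> balanced m L"
  by (simp add: balanced_def)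

lemma polar_value_simps [simp]:
  "polar_value m [] xs ys = 0"
  "polar_value m ((c, us, vs) # L) xs ys = c * polar m us xs * polar m vs ys + polar_value m L xs ys"
  by (simp_all add: polar_value_def)

text \<open>\<open>polar\<close> is the permanent of the matrix with entries
  \<open>coord (xs k) (us ! h)\<close>, so Ryser's formula applies. When all \<open>xs k\<close>
  coincide, it is m! times the monomial.\<close>

lemma polar_conv_mono_value:
  assumes "length us = m"
  shows "polar m us xs =
    (\<Sum>S\<in>Pow {..<m}. (-1) ^ (m - card S) * mono_value us (\<lambda>i a b. \<Sum>k\<in>S. xs k i a b))"
proof -
  have "coord (\<lambda>i a b. \<Sum>k\<in>S. xs k i a b) u = (\<Sum>k\<in>S. coord (xs k) u)" for S u
    by (cases u) (simp add: coord_def)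
  then show ?thesis
    using polarization[of "{..<m}" "\<lambda>h k. coord (xs k) (us ! h)"]
    by (simp add: polar_def mono_value_conv_prod assms)
qed

lemma polar_value_conv_poly_value:
  assumes "balanced m L"
  shows "polar_value m L xs ys =
    (\<Sum>S\<in>Pow {..<m}. \<Sum>T\<in>Pow {..<m}. (-1) ^ (m - card S) * (-1) ^ (m - card T) *
       poly_value L (\<lambda>i a b. \<Sum>k\<in>S. xs k i a b) (\<lambda>i a b. \<Sum>k\<in>T. ys k i a b))"
  using assms
proof (induction L)
  case (Cons e L)
  obtain c us vs where e: "e = (c, us, vs)" by (cases e) auto
  have len: "length us = m" "length vs = m" using Cons.prems by (auto simp: e)
  have "c * polar m us xs * polar m vs ys =
    (\<Sum>S\<in>Pow {..<m}. \<Sum>T\<in>Pow {..<m}. (-1) ^ (m - card S) * (-1) ^ (m - card T) *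
       (c * mono_value us (\<lambda>i a b. \<Sum>k\<in>S. xs k i a b) * mono_value vs (\<lambda>i a b. \<Sum>k\<in>T. ys k i a b)))"
    unfolding polar_conv_mono_value[OF len(1)] polar_conv_mono_value[OF len(2)]
    unfolding sum_distrib_left sum_distrib_right
    by (subst sum.swap) (simp only: mult_ac)
  then show ?case using Cons by (simp add: e ring_distribs sum.distrib)
qed simp

text \<open>Single terms of \<open>L\<close> need not be invariant, only their sum is. Hence the
  multilinear form is written through values of the whole polynomial at sums of arguments, on which
  the action is additive.\<close>

lemma polar_value_invariant:
  fixes L :: "'k::field poly_term list"
  assumes "balanced m L" "invariant_terms N L" "inverse_pair N g g'"
    and "\<And>k. symmetric_family (xs k)" "\<And>k. symmetric_family (ys k)"
  shows "polar_value m L (\<lambda>k i. gl_act N g (xs k i)) (\<lambda>k i. gl_coact N g' (ys k i)) = polar_value m L xs ys"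
proof -
  have "poly_value L (\<lambda>i a b. \<Sum>k\<in>S. gl_act N g (xs k i) a b) (\<lambda>i a b. \<Sum>k\<in>T. gl_coact N g' (ys k i) a b) =
      poly_value L (\<lambda>i a b. \<Sum>k\<in>S. xs k i a b) (\<lambda>i a b. \<Sum>k\<in>T. ys k i a b)" for S T
  proof -
    have "symmetric_family (\<lambda>i a b. \<Sum>k\<in>S. xs k i a b)" "symmetric_family (\<lambda>i a b. \<Sum>k\<in>T. ys k i a b)"
      using assms(4,5) unfolding symmetric_family_def by (metis (no_types, lifting) sum.cong)+
    then show ?thesis
      using assms(2,3) unfolding invariant_terms_def
      by (simp only: gl_act_sum[symmetric] gl_coact_sum[symmetric])
  qed
  then show ?thesis by (simp only: polar_value_conv_poly_value[OF assms(1)])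
qed

text \<open>Argument \<open>k\<close> becomes a family concentrated at position
  \<open>\<iota> k\<close>. Symmetrizing makes it admissible for \<open>invariant_terms\<close>
  whatever \<open>X k\<close> is, elementary matrices included.\<close>

definition inject :: "(nat \<Rightarrow> nat) \<Rightarrow> (nat \<Rightarrow> nat \<Rightarrow> nat \<Rightarrow> 'k::field) \<Rightarrow> nat \<Rightarrow> 'k mat_family" where
  "inject \<iota> X k i a b = (if i = \<iota> k then (X k a b + X k b a) / 2 else 0)"

lemma symmetric_inject: "symmetric_family (inject \<iota> X k)"
  by (simp add: symmetric_family_def inject_def add.commute)

lemma gl_act_transpose: "gl_act N g (\<lambda>a b. X b a) a b = gl_act N g X b a"
  unfolding gl_act_def by (subst sum.swap) (simp only: mult_ac)

lemma gl_coact_transpose: "gl_coact N g (\<lambda>a b. X b a) a b = gl_coact N g X b a"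
  unfolding gl_coact_def by (subst sum.swap) (simp only: mult_ac)

lemma gl_act_inject: "gl_act N g (inject \<iota> X k i) = inject \<iota> (\<lambda>h. gl_act N g (X h)) k i"
proof (cases "i = \<iota> k")
  case True
  have act: "gl_act N g (\<lambda>a b. (X k a b + X k b a) / 2) a b = (gl_act N g (X k) a b + gl_act N g (X k) b a) / 2" for a b
  proof -
    have "gl_act N g (\<lambda>a b. (X k a b + X k b a) / 2) a b =
        (gl_act N g (X k) a b + gl_act N g (\<lambda>a b. X k b a) a b) / 2"
      unfolding gl_act_def sum.distrib[symmetric] sum_divide_distrib
      by (intro sum.cong refl) (simp add: field_simps)
    then show ?thesis by (simp only: gl_act_transpose[of N g "X k"])
  qed
  have inj: "inject \<iota> X k i = (\<lambda>a b. (X k a b + X k b a) / 2)"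
    by (simp add: inject_def True fun_eq_iff)
  show ?thesis unfolding inj act by (intro ext) (simp only: act inject_def True simp_thms if_True)
next
  case False
  then show ?thesis by (simp add: inject_def gl_act_def fun_eq_iff)
qed

lemma gl_coact_inject: "gl_coact N g (inject \<iota> X k i) = inject \<iota> (\<lambda>h. gl_coact N g (X h)) k i"
proof -
  have "gl_coact N g Y = gl_act N (\<lambda>a b. g b a) Y" for Y
    by (simp add: gl_act_def gl_coact_def fun_eq_iff)
  then show ?thesis by (simp add: gl_act_inject)
qed

text \<open>Coefficients of the linear form that takes \<open>X k\<close> to coordinate
  \<open>u\<close> of its injected family; the two indicator products stem from the
  symmetrization.\<close>

definition inject_weight :: "(nat \<Rightarrow> nat) \<Rightarrow> nat \<Rightarrow> coordinate \<Rightarrow> nat \<Rightarrow> nat \<Rightarrow> 'k::field" where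
  "inject_weight \<iota> k u p q = (case u of (i, a, b) \<Rightarrow>
     (if i = \<iota> k then (of_bool (a = p) * of_bool (b = q) + of_bool (b = p) * of_bool (a = q)) / 2 else 0))"

lemma coord_inject:
  assumes "u \<in> {1..d} \<times> {..<N} \<times> {..<N}"
  shows "coord (inject \<iota> X k) u = (\<Sum>p<N. \<Sum>q<N. inject_weight \<iota> k u p q * X k p q)"
proof -
  obtain i a b where u: "u = (i, a, b)" "a < N" "b < N" using assms by auto
  have e: "(\<Sum>p<N. (\<Sum>q<N. (X k p q / 2) * of_bool (b = q)) * of_bool (a = p)) = X k a b / 2"
    "(\<Sum>p<N. (\<Sum>q<N. (X k p q / 2) * of_bool (a = q)) * of_bool (b = p)) = X k b a / 2"
    using u by (simp_all only: sum_mult_of_bool finite_lessThan lessThan_iff if_True)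
  show ?thesis
  proof (cases "i = \<iota> k")
    case True
    have "(\<Sum>p<N. \<Sum>q<N. inject_weight \<iota> k u p q * X k p q) = X k a b / 2 + X k b a / 2"
      unfolding e[symmetric] sum.distrib[symmetric] sum_distrib_right
      by (intro sum.cong refl) (simp add: u True inject_weight_def field_simps)
    then show ?thesis by (simp add: coord_def u inject_def True add_divide_distrib)
  next
    case False
    then show ?thesis by (simp add: coord_def u inject_def inject_weight_def)
  qed
qed

definition polar_coeff :: "nat \<Rightarrow> (nat \<Rightarrow> nat) \<Rightarrow> coordinate list \<Rightarrow> (nat \<times> bool \<Rightarrow> nat) \<Rightarrow> 'k::field" where
  "polar_coeff m \<iota> us I = (\<Sum>p | p permutes {..<m}.
     slot_prod m (\<lambda>k. inject_weight \<iota> k (us ! Hilbert_Choice.inv p k)) I)"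

lemma polar_inject:
  assumes "length us = m" "valid_coords N d us"
  shows "polar m us (inject \<iota> X) =
    (\<Sum>I\<in>words (slots m) N. polar_coeff m \<iota> us I * slot_prod m X I)"
proof -
  have "(\<Prod>h<m. coord (inject \<iota> X (p h)) (us ! h)) =
      (\<Sum>I\<in>words (slots m) N. slot_prod m (\<lambda>k. inject_weight \<iota> k (us ! Hilbert_Choice.inv p k)) I * slot_prod m X I)"
    if p: "p permutes {..<m}" for p
  proof -
    let ?q = "Hilbert_Choice.inv p"
    \<comment> \<open>The factors are reordered by argument \<open>k = p h\<close>, as
      \<open>slot_prod\<close> groups them; the coordinate belonging to \<open>k\<close> is then
      found through the inverse permutation.\<close>
    have "(\<Prod>k<m. coord (inject \<iota> X k) (us ! ?q k)) = (\<Prod>h<m. coord (inject \<iota> X (p h)) (us ! h))"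
      by (subst prod.permute[OF p]) (simp add: comp_def permutes_inverses[OF p])
    moreover have "(\<Prod>k<m. coord (inject \<iota> X k) (us ! ?q k)) =
        (\<Prod>k<m. \<Sum>a<N. \<Sum>b<N. inject_weight \<iota> k (us ! ?q k) a b * X k a b)"
    proof (intro prod.cong refl coord_inject)
      fix k assume "k \<in> {..<m}"
      then have "?q k < length us" using permutes_in_image[OF permutes_inv[OF p]] assms(1) by auto
      then show "us ! ?q k \<in> {1..d} \<times> {..<N} \<times> {..<N}"
        using assms(2) nth_mem unfolding valid_coords_def by blast
    qed
    ultimately show ?thesis
      unfolding prod_sum_slots by (simp add: slot_prod_def prod.distrib)
  qed
  then show ?thesis
    unfolding polar_def polar_coeff_def sum_distrib_right by (subst sum.swap) simp
qed

definition polar_tensor :: "nat \<Rightarrow> 'k::field poly_term list \<Rightarrow> (nat \<Rightarrow> nat) \<Rightarrow> (nat \<Rightarrow> nat) \<Rightarrow>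
    (nat \<times> bool \<Rightarrow> nat) \<Rightarrow> (nat \<times> bool \<Rightarrow> nat) \<Rightarrow> 'k" where
  "polar_tensor m L \<iota> \<kappa> I J =
     sum_list (map (\<lambda>(c, us, vs). c * polar_coeff m \<iota> us I * polar_coeff m \<kappa> vs J) L)"

lemma polar_value_inject:
  assumes "balanced m L" "valid_terms N d1 d2 L"
  shows "polar_value m L (inject \<iota> X) (inject \<kappa> Y) = tensor_form N m (polar_tensor m L \<iota> \<kappa>) X Y"
  using assms
proof (induction L)
  case Nil
  then show ?case by (simp add: tensor_form_def polar_tensor_def)
next
  case (Cons e L)
  obtain c us vs where e: "e = (c, us, vs)" by (cases e) auto
  have len: "length us = m" "length vs = m" and v: "valid_coords N d1 us" "valid_coords N d2 vs"
    using Cons.prems by (auto simp: e)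
  have "c * polar m us (inject \<iota> X) * polar m vs (inject \<kappa> Y) =
      tensor_form N m (\<lambda>I J. c * polar_coeff m \<iota> us I * polar_coeff m \<kappa> vs J) X Y"
    unfolding polar_inject[OF len(1) v(1)] polar_inject[OF len(2) v(2)] tensor_form_def
      sum_distrib_left sum_distrib_right
    by (subst sum.swap) (simp only: mult_ac)
  then show ?case using Cons
    by (simp add: e tensor_form_def polar_tensor_def ring_distribs sum.distrib)
qed

text \<open>A symmetric family is the sum of its parts concentrated at single positions, and m!
  times the monomial is its polar form with equal arguments. Multilinearity gives the sum over all
  choices \<open>\<iota>\<close> of positions.\<close>

lemma mono_value_decompose:
  fixes x :: "'k::field_char_0 mat_family"
  assumes "length us = m" "valid_coords N d us" "symmetric_family x"
  shows "of_nat (card {p. p permutes {..<m}}) * mono_value us x =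
    (\<Sum>\<iota>\<in>PiE {..<m} (\<lambda>_. {1..d}). polar m us (inject \<iota> (\<lambda>k. x (\<iota> k))))"
proof -
  let ?F = "PiE {..<m} (\<lambda>_. {1..d})"
  define c where "c j h = (if fst (us ! h) = j then coord x (us ! h) else 0)" for j h
  have c: "coord (inject \<iota> (\<lambda>k. x (\<iota> k)) k) (us ! h) = c (\<iota> k) h" for \<iota> k h
    using assms(3) unfolding symmetric_family_def
    by (cases "us ! h") (simp add: coord_def inject_def c_def)
  have "(\<Sum>\<iota>\<in>?F. polar m us (inject \<iota> (\<lambda>k. x (\<iota> k)))) =
      (\<Sum>p | p permutes {..<m}. \<Sum>\<iota>\<in>?F. \<Prod>h<m. c ((\<iota> \<circ> p) h) h)"
    unfolding polar_def c comp_def by (rule sum.swap)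
  also have "\<dots> = (\<Sum>p | p permutes {..<m}. mono_value us x)"
  proof (rule sum.cong[OF refl])
    fix p assume "p \<in> {p. p permutes {..<m}}"
    then have p: "p permutes {..<m}" by simp
    have "(\<Sum>\<iota>\<in>?F. \<Prod>h<m. c ((\<iota> \<circ> p) h) h) = (\<Sum>\<iota>\<in>?F. \<Prod>h<m. c (\<iota> h) h)"
      by (rule sum_PiE_permute[OF p])
    also have "\<dots> = (\<Prod>h<m. \<Sum>j\<in>{1..d}. c j h)" by (rule prod_sum_PiE[symmetric]) auto
    also have "\<dots> = (\<Prod>h<m. coord x (us ! h))"
    proof (rule prod.cong[OF refl])
      fix h assume "h \<in> {..<m}"
      then have "us ! h \<in> {1..d} \<times> {..<N} \<times> {..<N}"
        using assms(1,2) nth_mem unfolding valid_coords_def by blast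
      then show "(\<Sum>j\<in>{1..d}. c j h) = coord x (us ! h)" by (auto simp: c_def)
    qed
    finally show "(\<Sum>\<iota>\<in>?F. \<Prod>h<m. c ((\<iota> \<circ> p) h) h) = mono_value us x"
      by (simp add: mono_value_conv_prod assms(1))
  qed
  finally show ?thesis by simp
qed

lemma poly_value_decompose:
  fixes x y :: "'k::field_char_0 mat_family"
  assumes "balanced m L" "valid_terms N d1 d2 L" "symmetric_family x" "symmetric_family y"
  shows "of_nat (card {p. p permutes {..<m}}) ^ 2 * poly_value L x y =
    (\<Sum>\<iota>\<in>PiE {..<m} (\<lambda>_. {1..d1}). \<Sum>\<kappa>\<in>PiE {..<m} (\<lambda>_. {1..d2}).
       polar_value m L (inject \<iota> (\<lambda>k. x (\<iota> k))) (inject \<kappa> (\<lambda>k. y (\<kappa> k))))"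
  using assms(1,2)
proof (induction L)
  case (Cons e L)
  obtain c us vs where e: "e = (c, us, vs)" by (cases e) auto
  let ?n = "of_nat (card {p. p permutes {..<m}}) :: 'k"
  have len: "length us = m" "length vs = m" and v: "valid_coords N d1 us" "valid_coords N d2 vs"
    using Cons.prems by (auto simp: e)
  have "?n ^ 2 * (c * mono_value us x * mono_value vs y) = c * (?n * mono_value us x) * (?n * mono_value vs y)"
    by (simp add: power2_eq_square mult_ac)
  also have "\<dots> = (\<Sum>\<iota>\<in>PiE {..<m} (\<lambda>_. {1..d1}). \<Sum>\<kappa>\<in>PiE {..<m} (\<lambda>_. {1..d2}).
      c * polar m us (inject \<iota> (\<lambda>k. x (\<iota> k))) * polar m vs (inject \<kappa> (\<lambda>k. y (\<kappa> k))))"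
    unfolding mono_value_decompose[OF len(1) v(1) assms(3)] mono_value_decompose[OF len(2) v(2) assms(4)]
      sum_distrib_left sum_distrib_right
    by (rule sum.swap)
  finally show ?case using Cons by (simp add: e ring_distribs sum.distrib)
qed simp

text \<open>For a balanced component, the choices \<open>\<iota>\<close> and \<open>\<kappa>\<close>
  express (m!)^2 times its value as a sum of tensor forms, each invariant at arbitrary matrices and
  evaluated at the symmetric \<open>Q (\<iota> k)\<close> and \<open>R (\<kappa> k)\<close>.\<close>

theorem invariant_polynomial_in_algebra:
  fixes L :: "'k::field_char_0 poly_term list"
    and Q R :: "nat \<Rightarrow> 'w \<Rightarrow> nat \<Rightarrow> nat \<Rightarrow> 'k"
  assumes valid: "valid_terms N d1 d2 L" and inv: "invariant_terms N L"
    and symQ: "\<And>i w a b. Q i w a b = Q i w b a" and symR: "\<And>i w a b. R i w a b = R i w b a"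
    and tr: "\<And>A j. A \<in> chains N (Q ` {1..d1}) (R ` {1..d2}) \<Longrightarrow> j \<in> {1..d2} \<Longrightarrow>
               in_algebra Z S (\<lambda>w. \<Sum>a<N. \<Sum>b<N. A w a b * R j w b a)"
  shows "in_algebra Z S (\<lambda>w. poly_value L (\<lambda>i. Q i w) (\<lambda>j. R j w))"
proof -
  have sf: "symmetric_family (\<lambda>i. Q i w)" "symmetric_family (\<lambda>i. R i w)" for w
    unfolding symmetric_family_def using symQ symR by blast+
  have diag: "in_algebra Z S (\<lambda>w. poly_value (component m m L) (\<lambda>i. Q i w) (\<lambda>j. R j w))" for m
  proof -
    let ?L = "component m m L"
    let ?F = "PiE {..<m} (\<lambda>_. {1..d1})" and ?G = "PiE {..<m} (\<lambda>_. {1..d2})"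
    have bal: "balanced m ?L" by (auto simp: balanced_def component_def)
    have val: "valid_terms N d1 d2 ?L" by (rule valid_component[OF valid])
    have invL: "invariant_terms N ?L" by (rule invariant_component[OF inv])
    define n where "n = (of_nat (card {p. p permutes {..<m}}) :: 'k)"
    have n: "n \<noteq> 0" using finite_permutations[of "{..<m}"] permutes_id[of "{..<m}"]
      by (auto simp: n_def card_eq_0_iff simp del: permutes_id)
    have "in_algebra Z S (\<lambda>w. (1 / n ^ 2) * (\<Sum>\<iota>\<in>?F. \<Sum>\<kappa>\<in>?G.
       tensor_form N m (polar_tensor m ?L \<iota> \<kappa>) (\<lambda>k. Q (\<iota> k) w) (\<lambda>k. R (\<kappa> k) w)))"
    proof (rule in_algebra_mult[OF in_algebra_const], rule in_algebra_sum, rule in_algebra_sum)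
      fix \<iota> \<kappa> assume F: "\<iota> \<in> ?F" "\<kappa> \<in> ?G"
      show "in_algebra Z S (\<lambda>w. tensor_form N m (polar_tensor m ?L \<iota> \<kappa>) (\<lambda>k. Q (\<iota> k) w) (\<lambda>k. R (\<kappa> k) w))"
      proof (rule invariant_tensor_form_in_algebra[where \<Q> = "Q ` {1..d1}" and \<R> = "R ` {1..d2}"])
        fix g g' :: "nat \<Rightarrow> nat \<Rightarrow> 'k" and X Y :: "nat \<Rightarrow> nat \<Rightarrow> nat \<Rightarrow> 'k" assume g: "inverse_pair N g g'"
        show "tensor_form N m (polar_tensor m ?L \<iota> \<kappa>) (\<lambda>h. gl_act N g (X h)) (\<lambda>h. gl_coact N g' (Y h)) =
            tensor_form N m (polar_tensor m ?L \<iota> \<kappa>) X Y"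
          using polar_value_invariant[where xs = "inject \<iota> X" and ys = "inject \<kappa> Y",
              OF bal invL g symmetric_inject symmetric_inject]
          by (simp only: gl_act_inject gl_coact_inject polar_value_inject[OF bal val])
      next
        show "\<forall>A\<in>Q ` {1..d1} \<union> R ` {1..d2}. \<forall>w a b. A w a b = A w b a"
          using symQ symR by blast
        show "in_algebra Z S (\<lambda>w. \<Sum>a<N. \<Sum>b<N. A w a b * B w b a)"
          if "A \<in> chains N (Q ` {1..d1}) (R ` {1..d2})" "B \<in> R ` {1..d2}" for A B
          using tr[OF that(1)] that(2) by auto
        show "Q (\<iota> h) \<in> Q ` {1..d1}" "R (\<kappa> h) \<in> R ` {1..d2}" if "h < m" for h
          using F that by (auto simp: PiE_iff)
      qed
    qed
    moreover have "poly_value ?L (\<lambda>i. Q i w) (\<lambda>j. R j w) = (1 / n ^ 2) * (\<Sum>\<iota>\<in>?F. \<Sum>\<kappa>\<in>?G.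
       tensor_form N m (polar_tensor m ?L \<iota> \<kappa>) (\<lambda>k. Q (\<iota> k) w) (\<lambda>k. R (\<kappa> k) w))" for w
      using poly_value_decompose[OF bal val sf[of w]] n
      by (simp add: polar_value_inject[OF bal val] n_def[symmetric] nonzero_eq_divide_eq mult.commute)
    ultimately show ?thesis by (simp only:)
  qed
  define d where "d = sum_list (map (\<lambda>(c, us, vs). length us + length vs) L)"
  have d: "\<forall>(c, us, vs)\<in>set L. length us \<le> d \<and> length vs \<le> d"
  proof -
    have "length us + length vs \<le> d" if "(c, us, vs) \<in> set L" for c us vs
      unfolding d_def using that by (intro member_le_sum_list; force)
    then show ?thesis by fastforce
  qed
  have "poly_value L (\<lambda>i. Q i w) (\<lambda>j. R j w) =
      (\<Sum>m\<le>d. poly_value (component m m L) (\<lambda>i. Q i w) (\<lambda>j. R j w))" for w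
  proof -
    have "poly_value L (\<lambda>i. Q i w) (\<lambda>j. R j w) =
        (\<Sum>p\<le>d. \<Sum>q\<le>d. poly_value (component p q L) (\<lambda>i. Q i w) (\<lambda>j. R j w))"
      using poly_value_components[OF d, of 1 "\<lambda>i. Q i w" 1 "\<lambda>j. R j w"] by simp
    \<comment> \<open>Unbalanced components vanish, so \<open>p\<close> may be replaced by
      \<open>q\<close> at the price of an indicator.\<close>
    also have "\<dots> = (\<Sum>p\<le>d. \<Sum>q\<le>d. poly_value (component q q L) (\<lambda>i. Q i w) (\<lambda>j. R j w) * of_bool (p = q))"
      using unbalanced_component_zero[OF valid inv _ sf] by (intro sum.cong refl) auto
    also have "\<dots> = (\<Sum>p\<le>d. poly_value (component p p L) (\<lambda>i. Q i w) (\<lambda>j. R j w))"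
      by (intro sum.cong refl) (simp only: sum_mult_of_bool finite_atMost if_True)
    finally show ?thesis .
  qed
  then show ?thesis using in_algebra_sum[of "{..d}" Z S, OF diag] by (simp only:)
qed

section \<open>Trace functions\<close>

lemma gen_algebra_restrict: "f \<in> gen_algebra X S \<Longrightarrow> restrict f X = f"
  by (induction rule: gen_algebra.cases) (auto simp: fun_eq_iff)

lemma W_space_entries:
  assumes "w \<in> W_space N d1 d2"
  shows "i \<in> {1..d1} \<Longrightarrow> fst w i \<in> carrier_mat N N"
    and "i \<in> {1..d1} \<Longrightarrow> transpose_mat (fst w i) = fst w i"
    and "j \<in> {1..d2} \<Longrightarrow> snd w j \<in> carrier_mat N N"
    and "j \<in> {1..d2} \<Longrightarrow> transpose_mat (snd w j) = snd w j"
  using assms by (auto simp: W_space_def sym_mats_def PiE_iff)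

lemma symmetric_mat_entry:
  assumes "A \<in> carrier_mat N N" "transpose_mat A = A" "a < N" "b < N"
  shows "A $$ (a, b) = A $$ (b, a)"
proof -
  have "transpose_mat A $$ (a, b) = A $$ (b, a)" using assms(1,3,4) by simp
  then show ?thesis by (simp only: assms(2))
qed

text \<open>The value 0 off the space and out of range makes the entries symmetric for all
  \<open>w\<close>, \<open>a\<close> and \<open>b\<close>, as the contraction argument
  demands.\<close>

definition Q_entry :: "nat \<Rightarrow> nat \<Rightarrow> nat \<Rightarrow> nat \<Rightarrow> 'k::field sym_pair \<Rightarrow> nat \<Rightarrow> nat \<Rightarrow> 'k" where
  "Q_entry N d1 d2 i w a b =
     (if w \<in> W_space N d1 d2 \<and> i \<in> {1..d1} \<and> a < N \<and> b < N then fst w i $$ (a, b) else 0)"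

definition R_entry :: "nat \<Rightarrow> nat \<Rightarrow> nat \<Rightarrow> nat \<Rightarrow> 'k::field sym_pair \<Rightarrow> nat \<Rightarrow> nat \<Rightarrow> 'k" where
  "R_entry N d1 d2 j w a b =
     (if w \<in> W_space N d1 d2 \<and> j \<in> {1..d2} \<and> a < N \<and> b < N then snd w j $$ (a, b) else 0)"

lemma Q_entry_symmetric: "Q_entry N d1 d2 i w a b = Q_entry N d1 d2 i w b a"
  unfolding Q_entry_def
  using symmetric_mat_entry[OF W_space_entries(1)[of w N d1 d2 i] W_space_entries(2)[of w N d1 d2 i]] by auto

lemma R_entry_symmetric: "R_entry N d1 d2 i w a b = R_entry N d1 d2 i w b a"
  unfolding R_entry_def
  using symmetric_mat_entry[OF W_space_entries(3)[of w N d1 d2 i] W_space_entries(4)[of w N d1 d2 i]] by auto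

section \<open>Polynomial functions as lists of terms\<close>

lemma mono_value_append: "mono_value (us @ us') x = mono_value us x * mono_value us' x"
  by (simp add: mono_value_def)

lemma poly_value_append: "poly_value (L @ L') x y = poly_value L x y + poly_value L' x y"
  by (simp add: poly_value_def)

definition mult_terms :: "'k::comm_ring_1 poly_term list \<Rightarrow> 'k poly_term list \<Rightarrow> 'k poly_term list" where
  "mult_terms L L' = concat (map (\<lambda>(c, us, vs). map (\<lambda>(c', us', vs'). (c * c', us @ us', vs @ vs')) L') L)"

lemma poly_value_mult_terms: "poly_value (mult_terms L L') x y = poly_value L x y * poly_value L' x y"
proof (induction L)
  case (Cons e L)
  obtain c us vs where e: "e = (c, us, vs)" by (cases e) auto
  have "poly_value (map (\<lambda>(c', us', vs'). (c * c', us @ us', vs @ vs')) L') x y =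
      c * mono_value us x * mono_value vs y * poly_value L' x y"
    by (induction L') (auto simp: mono_value_append algebra_simps)
  then show ?case using Cons by (simp add: mult_terms_def e poly_value_append algebra_simps)
qed (simp add: mult_terms_def)

lemma valid_mult_terms:
  "valid_terms N d1 d2 L \<Longrightarrow> valid_terms N d1 d2 L' \<Longrightarrow> valid_terms N d1 d2 (mult_terms L L')"
  by (fastforce simp: valid_terms_def mult_terms_def valid_coords_def)

lemma polynomial_function_terms:
  assumes "f \<in> polynomial_functions N d1 d2"
  shows "\<exists>L. valid_terms N d1 d2 L \<and> (\<forall>w\<in>W_space N d1 d2.
    f w = poly_value L (\<lambda>i. Q_entry N d1 d2 i w) (\<lambda>j. R_entry N d1 d2 j w))"
  using assms unfolding polynomial_functions_def
proof induction
  case (const c)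
  show ?case
    by (intro exI[of _ "[(c, [], [])]"]) (simp add: valid_terms_def valid_coords_def mono_value_def)
next
  case (gen f)
  then consider i a b where "f = (\<lambda>w. fst w i $$ (a, b))" "i \<in> {1..d1}" "a < N" "b < N"
    | j a b where "f = (\<lambda>w. snd w j $$ (a, b))" "j \<in> {1..d2}" "a < N" "b < N"
    unfolding coordinate_functions_def by blast
  then show ?case
  proof cases
    case 1
    then show ?thesis
      by (intro exI[of _ "[(1, [(i, a, b)], [])]"])
        (auto simp: valid_terms_def valid_coords_def mono_value_def coord_def Q_entry_def)
  next
    case 2
    then show ?thesis
      by (intro exI[of _ "[(1, [], [(j, a, b)])]"])
        (auto simp: valid_terms_def valid_coords_def mono_value_def coord_def R_entry_def)
  qed
next
  case (add f h)
  then obtain L L' where "valid_terms N d1 d2 L" "valid_terms N d1 d2 L'"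
    "\<forall>w\<in>W_space N d1 d2. f w = poly_value L (\<lambda>i. Q_entry N d1 d2 i w) (\<lambda>j. R_entry N d1 d2 j w)"
    "\<forall>w\<in>W_space N d1 d2. h w = poly_value L' (\<lambda>i. Q_entry N d1 d2 i w) (\<lambda>j. R_entry N d1 d2 j w)"
    by blast
  then show ?case
    by (intro exI[of _ "L @ L'"]) (auto simp: poly_value_append valid_terms_def)
next
  case (mult f h)
  then obtain L L' where "valid_terms N d1 d2 L" "valid_terms N d1 d2 L'"
    "\<forall>w\<in>W_space N d1 d2. f w = poly_value L (\<lambda>i. Q_entry N d1 d2 i w) (\<lambda>j. R_entry N d1 d2 j w)"
    "\<forall>w\<in>W_space N d1 d2. h w = poly_value L' (\<lambda>i. Q_entry N d1 d2 i w) (\<lambda>j. R_entry N d1 d2 j w)"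
    by blast
  then show ?case
    by (intro exI[of _ "mult_terms L L'"]) (auto simp: poly_value_mult_terms valid_mult_terms)
qed

section \<open>The matrix group and its action in index form\<close>

lemma carrier_GL:
  fixes g :: "'k::field mat"
  shows "g \<in> carrier (GL N) \<longleftrightarrow> g \<in> carrier_mat N N \<and> (\<exists>h\<in>carrier_mat N N. h * g = 1\<^sub>m N \<and> g * h = 1\<^sub>m N)"
  by (auto simp: GL_def units_of_def Units_def ring_mat_def)

lemma inv_GL:
  fixes g :: "'k::field mat"
  assumes "g \<in> carrier_mat N N" "h \<in> carrier_mat N N" "h * g = 1\<^sub>m N" "g * h = 1\<^sub>m N"
  shows "inv\<^bsub>GL N\<^esub> g = h"
proof -
  interpret R: ring "ring_mat TYPE('k) N ()" by (rule ring_mat)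
  interpret group "GL N :: 'k mat monoid" unfolding GL_def by (rule R.units_group)
  have "g \<in> carrier (GL N)" "h \<in> carrier (GL N)" using assms by (auto simp: carrier_GL)
  moreover have "h \<otimes>\<^bsub>GL N\<^esub> g = \<one>\<^bsub>GL N\<^esub>"
    using assms(3) by (simp add: GL_def units_of_def ring_mat_def)
  ultimately show ?thesis by (intro inv_equality)
qed

lemma GL_inverse:
  fixes g :: "'k::field mat"
  assumes "g \<in> carrier (GL N)"
  shows "g \<in> carrier_mat N N" "inv\<^bsub>GL N\<^esub> g \<in> carrier_mat N N"
    "inv\<^bsub>GL N\<^esub> g * g = 1\<^sub>m N" "g * inv\<^bsub>GL N\<^esub> g = 1\<^sub>m N"
  using assms inv_GL unfolding carrier_GL by metis+

lemma GL_act_in_W_space: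
  assumes g: "g \<in> carrier (GL N)" and w: "w \<in> W_space N d1 d2"
  shows "GL_act N d1 d2 g w \<in> W_space N d1 d2"
proof -
  note G = GL_inverse[OF g] and W = W_space_entries[OF w]
  have sym: "h * A * transpose_mat h \<in> sym_mats N"
    if "h \<in> carrier_mat N N" "A \<in> carrier_mat N N" "transpose_mat A = A" for h A
  proof -
    have "transpose_mat (h * A * transpose_mat h) = h * (A * transpose_mat h)"
      using that by (simp add: transpose_mult[of _ N N _ N])
    also have "\<dots> = h * A * transpose_mat h" using that by (simp add: assoc_mult_mat[of _ N N _ N _ N])
    finally show ?thesis using that by (simp add: sym_mats_def)
  qed
  show ?thesis
    unfolding GL_act_def W_space_def mem_Times_iff fst_conv snd_conv
    using sym[OF G(1) W(1,2)] sym[of "transpose_mat (inv\<^bsub>GL N\<^esub> g)", OF _ W(3,4)] G(2)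
    by (auto simp: PiE_iff)
qed

lemma mult_mat_entry:
  assumes "A \<in> carrier_mat N N" "B \<in> carrier_mat N N" "a < N" "b < N"
  shows "(A * B) $$ (a, b) = (\<Sum>c<N. A $$ (a, c) * B $$ (c, b))"
  using assms by (auto simp: scalar_prod_def atLeast0LessThan intro!: sum.cong)

lemma mult3_mat_entry:
  assumes "A \<in> carrier_mat N N" "B \<in> carrier_mat N N" "C \<in> carrier_mat N N" "a < N" "b < N"
  shows "(A * B * C) $$ (a, b) = (\<Sum>q<N. (\<Sum>p<N. A $$ (a, p) * B $$ (p, q)) * C $$ (q, b))"
proof -
  have "(A * B * C) $$ (a, b) = (\<Sum>q<N. (A * B) $$ (a, q) * C $$ (q, b))"
    by (rule mult_mat_entry) (use assms in \<open>auto intro!: mult_carrier_mat\<close>)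
  also have "\<dots> = (\<Sum>q<N. (\<Sum>p<N. A $$ (a, p) * B $$ (p, q)) * C $$ (q, b))"
    by (intro sum.cong refl arg_cong2[where f="(*)"] mult_mat_entry) (use assms in auto)
  finally show ?thesis .
qed

text \<open>Invariance of \<open>f\<close> is known at points of the space, that of \<open>L\<close>
  is demanded for families indexed by all naturals. Validity bridges the gap: \<open>L\<close> reads
  only entries in range, and the point \<open>mk x y\<close> realizes these.\<close>

lemma invariant_function_terms:
  fixes f :: "'k::field sym_pair \<Rightarrow> 'k"
  assumes valid: "valid_terms N d1 d2 L"
    and f: "\<And>w. w \<in> W_space N d1 d2 \<Longrightarrow>
      f w = poly_value L (\<lambda>i. Q_entry N d1 d2 i w) (\<lambda>j. R_entry N d1 d2 j w)"
    and inv: "\<And>g w. g \<in> carrier (GL N) \<Longrightarrow> w \<in> W_space N d1 d2 \<Longrightarrow> f (GL_act N d1 d2 g w) = f w"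
  shows "invariant_terms N L"
  unfolding invariant_terms_def
proof (intro allI impI)
  fix g g' :: "nat \<Rightarrow> nat \<Rightarrow> 'k" and x y :: "'k mat_family"
  assume g: "inverse_pair N g g'" and xy: "symmetric_family x" "symmetric_family y"
  define M where "M X = mat N N (\<lambda>(a, b). X a b)" for X :: "nat \<Rightarrow> nat \<Rightarrow> 'k"
  have M: "M X \<in> carrier_mat N N" "a < N \<Longrightarrow> b < N \<Longrightarrow> M X $$ (a, b) = X a b" for X a b
    by (simp_all add: M_def)
  define mk where "mk x y = (\<lambda>i\<in>{1..d1}. M (x i), \<lambda>j\<in>{1..d2}. M (y j))" for x y :: "'k mat_family"
  have mkW: "mk x y \<in> W_space N d1 d2" if "symmetric_family x" "symmetric_family y" for x y
  proof -
    have "M X \<in> sym_mats N" if "\<And>a b. X a b = X b a" for X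
      using that by (auto simp: sym_mats_def M_def intro!: eq_matI)
    then show ?thesis using that by (auto simp: mk_def W_space_def symmetric_family_def PiE_iff)
  qed
  have mkf: "f (mk x y) = poly_value L x y" if "symmetric_family x" "symmetric_family y" for x y
    unfolding f[OF mkW[OF that]]
    by (rule poly_value_cong[OF valid]) (use mkW[OF that] in \<open>auto simp: Q_entry_def R_entry_def mk_def M\<close>)
  have MM: "(M A * M B) $$ (a, b) = (\<Sum>c<N. A a c * B c b)" if "a < N" "b < N" for A B a b
    by (subst mult_mat_entry[OF M(1) M(1) that]) (intro sum.cong refl, simp add: M that)
  have g1: "M g * M g' = 1\<^sub>m N" "M g' * M g = 1\<^sub>m N"
    using g by (auto intro!: eq_matI simp: MM inverse_pair_def carrier_matD[OF M(1)] simp del: index_mult_mat(1))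
  then have G: "M g \<in> carrier (GL N)" "inv\<^bsub>GL N\<^esub> (M g) = M g'"
    using M(1) by (auto simp: carrier_GL intro!: inv_GL)
  have A: "M g * M X * transpose_mat (M g) = M (gl_act N g X)" for X
  proof (rule eq_matI)
    fix a b assume "a < dim_row (M (gl_act N g X))" "b < dim_col (M (gl_act N g X))"
    then have ab: "a < N" "b < N" by (simp_all add: M_def)
    have "(M g * M X * transpose_mat (M g)) $$ (a, b) =
        (\<Sum>q<N. (\<Sum>p<N. M g $$ (a, p) * M X $$ (p, q)) * transpose_mat (M g) $$ (q, b))"
      by (rule mult3_mat_entry) (use ab M(1) in \<open>auto intro!: transpose_carrier_mat\<close>)
    also have "\<dots> = (\<Sum>q<N. \<Sum>p<N. g a p * X p q * g b q)"
      using ab by (intro sum.cong refl) (simp add: M_def sum_distrib_right)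
    also have "\<dots> = gl_act N g X a b" unfolding gl_act_def by (rule sum.swap)
    finally show "(M g * M X * transpose_mat (M g)) $$ (a, b) = M (gl_act N g X) $$ (a, b)"
      using ab by (simp add: M)
  qed (simp_all add: M_def)
  have T: "transpose_mat (M g') = M (\<lambda>a b. g' b a)" by (auto simp: M_def)
  have C: "transpose_mat (M g') * M X * M g' = M (gl_coact N g' X)" for X
  proof (rule eq_matI)
    fix a b assume "a < dim_row (M (gl_coact N g' X))" "b < dim_col (M (gl_coact N g' X))"
    then have ab: "a < N" "b < N" by (simp_all add: M_def)
    have "(M (\<lambda>a b. g' b a) * M X * M g') $$ (a, b) =
        (\<Sum>q<N. (\<Sum>p<N. M (\<lambda>a b. g' b a) $$ (a, p) * M X $$ (p, q)) * M g' $$ (q, b))"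
      by (rule mult3_mat_entry) (use ab M(1) in \<open>auto intro!: transpose_carrier_mat\<close>)
    also have "\<dots> = (\<Sum>q<N. \<Sum>p<N. g' p a * X p q * g' q b)"
      using ab by (intro sum.cong refl) (simp add: M_def sum_distrib_right)
    also have "\<dots> = gl_coact N g' X a b" unfolding gl_coact_def by (rule sum.swap)
    finally show "(transpose_mat (M g') * M X * M g') $$ (a, b) = M (gl_coact N g' X) $$ (a, b)"
      using ab by (simp add: M T)
  qed (simp_all add: M_def)
  have act: "GL_act N d1 d2 (M g) (mk x y) = mk (\<lambda>i. gl_act N g (x i)) (\<lambda>j. gl_coact N g' (y j))"
    by (auto simp: GL_act_def mk_def G(2) A C fun_eq_iff)
  have "symmetric_family (\<lambda>i. gl_act N g (x i))"
    unfolding symmetric_family_def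
  proof (intro allI)
    fix i a b
    have "(\<lambda>a b. x i b a) = x i" using xy unfolding symmetric_family_def by blast
    then show "gl_act N g (x i) a b = gl_act N g (x i) b a" using gl_act_transpose[of N g "x i" a b] by simp
  qed
  moreover have "symmetric_family (\<lambda>j. gl_coact N g' (y j))"
    unfolding symmetric_family_def
  proof (intro allI)
    fix i a b
    have "(\<lambda>a b. y i b a) = y i" using xy unfolding symmetric_family_def by blast
    then show "gl_coact N g' (y i) a b = gl_coact N g' (y i) b a" using gl_coact_transpose[of N g' "y i" a b] by simp
  qed
  ultimately show "poly_value L (\<lambda>i. gl_act N g (x i)) (\<lambda>j. gl_coact N g' (y j)) = poly_value L x y"
    using inv[OF G(1) mkW[OF xy]] by (simp only: act mkf mkf[OF xy])
qed

section \<open>Products of blocks Q R and their traces\<close>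

definition QR_product :: "nat \<Rightarrow> (nat \<times> nat) list \<Rightarrow> 'k::field sym_pair \<Rightarrow> 'k mat" where
  "QR_product N ps w = foldr (*) (map (\<lambda>(n, m). fst w n * snd w m) ps) (1\<^sub>m N)"

lemma QR_product_simps [simp]:
  "QR_product N [] w = 1\<^sub>m N"
  "QR_product N ((n, m) # ps) w = fst w n * snd w m * QR_product N ps w"
  by (simp_all add: QR_product_def)

lemma QR_product_carrier:
  assumes "w \<in> W_space N d1 d2" "set ps \<subseteq> {1..d1} \<times> {1..d2}"
  shows "QR_product N ps w \<in> carrier_mat N N"
  using assms(2)
proof (induction ps)
  case (Cons p ps)
  then show ?case using W_space_entries[OF assms(1)] by (cases p) (auto intro!: mult_carrier_mat)
qed simp

lemma QR_product_append:
  assumes w: "w \<in> W_space N d1 d2" and "set ps \<subseteq> {1..d1} \<times> {1..d2}" "set qs \<subseteq> {1..d1} \<times> {1..d2}"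
  shows "QR_product N (ps @ qs) w = QR_product N ps w * QR_product N qs w"
  using assms(2)
proof (induction ps)
  case Nil
  then show ?case using QR_product_carrier[OF w assms(3)] by simp
next
  case (Cons p ps)
  obtain n m where p: "p = (n, m)" by (cases p)
  have "fst w n * snd w m \<in> carrier_mat N N"
    using Cons.prems W_space_entries[OF w] by (auto simp: p intro!: mult_carrier_mat)
  then show ?case using Cons QR_product_carrier[OF w] assms(3)
    by (simp add: p assoc_mult_mat[of _ N N _ N _ N])
qed

lemma trace_function_conv:
  assumes "w \<in> W_space N d1 d2" "set ps \<subseteq> {1..d1} \<times> {1..d2}"
  shows "trace_function N ps w = (\<Sum>a<N. QR_product N ps w $$ (a, a))"
  using QR_product_carrier[OF assms] by (simp add: trace_function_def mat_trace_def QR_product_def)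

text \<open>A chain Q R Q ... R Q consists of blocks Q R followed by a last Q. Gluing through the
  \<open>j\<close>-th R completes the last block of the first chain, which is the new pair
  \<open>(i, j)\<close> in the middle.\<close>

lemma chain_QR_product:
  fixes A :: "'k::field sym_pair \<Rightarrow> nat \<Rightarrow> nat \<Rightarrow> 'k"
  assumes "A \<in> chains N (Q_entry N d1 d2 ` {1..d1}) (R_entry N d1 d2 ` {1..d2})"
  shows "\<exists>ps i. set ps \<subseteq> {1..d1} \<times> {1..d2} \<and> i \<in> {1..d1} \<and>
    (\<forall>w\<in>W_space N d1 d2. \<forall>a<N. \<forall>b<N. A w a b = (QR_product N ps w * fst w i) $$ (a, b))"
  using assms
proof induction
  case (base A)
  then obtain i where "i \<in> {1..d1}" "A = Q_entry N d1 d2 i" by blast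
  then show ?case
  proof (intro exI[of _ "[]"] exI[of _ i] conjI ballI allI impI)
    fix w :: "'k sym_pair" and a b assume w: "w \<in> W_space N d1 d2" and "a < N" "b < N"
    then have "A w a b = fst w i $$ (a, b)"
      using \<open>A = _\<close> \<open>i \<in> _\<close> by (simp add: Q_entry_def)
    then show "A w a b = (QR_product N [] w * fst w i) $$ (a, b)"
      using left_mult_one_mat[OF W_space_entries(1)[OF w \<open>i \<in> _\<close>]] by simp
  qed simp_all
next
  case (join A B A')
  from join.IH(1) obtain ps i where 1: "set ps \<subseteq> {1..d1} \<times> {1..d2}" "i \<in> {1..d1}"
      "\<forall>w\<in>W_space N d1 d2. \<forall>a<N. \<forall>b<N. A w a b = (QR_product N ps w * fst w i) $$ (a, b)"
    by (elim exE conjE)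
  from join.IH(2) obtain ps' i' where 2: "set ps' \<subseteq> {1..d1} \<times> {1..d2}" "i' \<in> {1..d1}"
      "\<forall>w\<in>W_space N d1 d2. \<forall>a<N. \<forall>b<N. A' w a b = (QR_product N ps' w * fst w i') $$ (a, b)"
    by (elim exE conjE)
  from join(2) obtain j where j: "j \<in> {1..d2}" "B = R_entry N d1 d2 j" by blast
  have "(\<Sum>c<N. \<Sum>d<N. A w a c * B w c d * A' w d b) =
      (QR_product N (ps @ (i, j) # ps') w * fst w i') $$ (a, b)"
    if w: "w \<in> W_space N d1 d2" and ab: "a < N" "b < N" for w a b
  proof -
    note W = W_space_entries[OF w] and P = QR_product_carrier[OF w]
    let ?A = "QR_product N ps w * fst w i" and ?A' = "QR_product N ps' w * fst w i'"
    have car: "?A \<in> carrier_mat N N" "?A' \<in> carrier_mat N N" "snd w j \<in> carrier_mat N N"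
      "QR_product N ps w \<in> carrier_mat N N" "QR_product N ps' w \<in> carrier_mat N N"
      "fst w i \<in> carrier_mat N N" "fst w i' \<in> carrier_mat N N"
      by (intro mult_carrier_mat[of _ N N] W(1,3) P 1(1,2) 2(1,2) j(1))+
    have "QR_product N (ps @ (i, j) # ps') w * fst w i' = ?A * snd w j * ?A'"
      using 1 2 j car by (simp add: QR_product_append[OF w] assoc_mult_mat[of _ N N _ N _ N])
    also have "\<dots> $$ (a, b) = (\<Sum>d<N. (\<Sum>c<N. ?A $$ (a, c) * snd w j $$ (c, d)) * ?A' $$ (d, b))"
      by (rule mult3_mat_entry[OF car(1) car(3) car(2) ab])
    also have "\<dots> = (\<Sum>d<N. \<Sum>c<N. A w a c * B w c d * A' w d b)"
      unfolding sum_distrib_right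
      using j(1) by (intro sum.cong refl) (simp add: 1(3)[rule_format, OF w] 2(3)[rule_format, OF w] ab j(2) w R_entry_def del: index_mult_mat)
    also have "\<dots> = (\<Sum>c<N. \<Sum>d<N. A w a c * B w c d * A' w d b)" by (rule sum.swap)
    finally show ?thesis by (rule sym)
  qed
  then show ?case using 1(1,2) 2(1,2) j
    by (intro exI[of _ "ps @ (i, j) # ps'"] exI[of _ i']) auto
qed

abbreviation trace_generators :: "nat \<Rightarrow> nat \<Rightarrow> nat \<Rightarrow> ('k::field sym_pair \<Rightarrow> 'k) set" where
  "trace_generators N d1 d2 \<equiv> {trace_function N ps | ps. length ps \<ge> 1 \<and> set ps \<subseteq> {1..d1} \<times> {1..d2}}"

text \<open>One more R completes the final block of the chain, so the closed cycle is the trace for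
  a nonempty list even when the chain is a single Q.\<close>

lemma chain_trace_in_algebra:
  assumes "A \<in> chains N (Q_entry N d1 d2 ` {1..d1}) (R_entry N d1 d2 ` {1..d2})" and j: "j \<in> {1..d2}"
  shows "in_algebra (W_space N d1 d2) (trace_generators N d1 d2)
    (\<lambda>w. \<Sum>a<N. \<Sum>b<N. A w a b * R_entry N d1 d2 j w b a)"
proof -
  from chain_QR_product[OF assms(1)] obtain ps i where ps: "set ps \<subseteq> {1..d1} \<times> {1..d2}" and i: "i \<in> {1..d1}"
    and A: "\<forall>w\<in>W_space N d1 d2. \<forall>a<N. \<forall>b<N. A w a b = (QR_product N ps w * fst w i) $$ (a, b)"
    by (elim exE conjE)
  have qs: "set (ps @ [(i, j)]) \<subseteq> {1..d1} \<times> {1..d2}" using ps i j by auto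
  then have "trace_function N (ps @ [(i, j)]) \<in> trace_generators N d1 d2" by force
  then have "in_algebra (W_space N d1 d2) (trace_generators N d1 d2) (trace_function N (ps @ [(i, j)]))"
    by (rule in_algebra_gen)
  moreover have "(\<Sum>a<N. \<Sum>b<N. A w a b * R_entry N d1 d2 j w b a) = trace_function N (ps @ [(i, j)]) w"
    if w: "w \<in> W_space N d1 d2" for w
  proof -
    note W = W_space_entries[OF w] and P = QR_product_carrier[OF w ps]
    have "QR_product N (ps @ [(i, j)]) w = QR_product N ps w * fst w i * snd w j"
      using ps i j W P right_mult_one_mat[OF W(3)[OF j]]
      by (simp add: QR_product_append[OF w] assoc_mult_mat[of _ N N _ N _ N])
    then have "trace_function N (ps @ [(i, j)]) w = (\<Sum>a<N. (QR_product N ps w * fst w i * snd w j) $$ (a, a))"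
      using trace_function_conv[OF w qs] by simp
    also have "\<dots> = (\<Sum>a<N. \<Sum>b<N. (QR_product N ps w * fst w i) $$ (a, b) * snd w j $$ (b, a))"
      by (intro sum.cong refl mult_mat_entry) (use W P i j in \<open>auto intro!: mult_carrier_mat\<close>)
    also have "\<dots> = (\<Sum>a<N. \<Sum>b<N. A w a b * R_entry N d1 d2 j w b a)"
      using j by (intro sum.cong refl) (simp add: A[rule_format, OF w] R_entry_def w del: index_mult_mat)
    finally show ?thesis by (rule HOL.sym)
  qed
  ultimately show ?thesis by (rule in_algebra_eqI)
qed

lemma trace_function_polynomial:
  fixes d1 d2 N :: nat
  assumes ps: "set ps \<subseteq> {1..d1} \<times> {1..d2}"
  shows "in_algebra (W_space N d1 d2) (coordinate_functions N d1 d2) (trace_function N ps :: 'k::field sym_pair \<Rightarrow> 'k)"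
proof -
  let ?alg = "in_algebra (W_space N d1 d2) (coordinate_functions N d1 d2 :: ('k sym_pair \<Rightarrow> 'k) set)"
  have entry: "?alg (\<lambda>w. QR_product N ps w $$ (a, b))" if "a < N" "b < N" for a b
    using ps that
  proof (induction ps arbitrary: a)
    case Nil
    then show ?case by (simp add: in_algebra_const)
  next
    case (Cons p ps)
    obtain n m where p: "p = (n, m)" "n \<in> {1..d1}" "m \<in> {1..d2}" "set ps \<subseteq> {1..d1} \<times> {1..d2}"
      using Cons.prems(1) by (cases p) auto
    have "?alg (\<lambda>w. \<Sum>d<N. (\<Sum>c<N. fst w n $$ (a, c) * snd w m $$ (c, d)) * QR_product N ps w $$ (d, b))"
    proof (rule in_algebra_sum, rule in_algebra_mult)
      fix d assume d: "d \<in> {..<N}"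
      then show "?alg (\<lambda>w. QR_product N ps w $$ (d, b))" using Cons p by simp
      show "?alg (\<lambda>w. \<Sum>c<N. fst w n $$ (a, c) * snd w m $$ (c, d))"
      proof (intro in_algebra_sum in_algebra_mult in_algebra_gen)
        fix c assume "c \<in> {..<N}"
        then show "(\<lambda>w. fst w n $$ (a, c)) \<in> coordinate_functions N d1 d2"
          "(\<lambda>w. snd w m $$ (c, d)) \<in> coordinate_functions N d1 d2"
          using p d Cons.prems unfolding coordinate_functions_def by blast+
      qed
    qed
    moreover have "QR_product N (p # ps) w $$ (a, b) =
        (\<Sum>d<N. (\<Sum>c<N. fst w n $$ (a, c) * snd w m $$ (c, d)) * QR_product N ps w $$ (d, b))"
      if w: "w \<in> W_space N d1 d2" for w
    proof -
      have car: "fst w n \<in> carrier_mat N N" "snd w m \<in> carrier_mat N N" "QR_product N ps w \<in> carrier_mat N N"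
        using W_space_entries[OF w] QR_product_carrier[OF w] p by auto
      have "QR_product N (p # ps) w $$ (a, b) = (\<Sum>d<N. (fst w n * snd w m) $$ (a, d) * QR_product N ps w $$ (d, b))"
        unfolding p(1) QR_product_simps
        by (rule mult_mat_entry) (use car Cons.prems in \<open>auto intro!: mult_carrier_mat\<close>)
      also have "\<dots> = (\<Sum>d<N. (\<Sum>c<N. fst w n $$ (a, c) * snd w m $$ (c, d)) * QR_product N ps w $$ (d, b))"
        by (intro sum.cong refl arg_cong2[where f="(*)"] mult_mat_entry) (use car Cons.prems in auto)
      finally show ?thesis .
    qed
    ultimately show ?case by (rule in_algebra_eqI)
  qed
  have "?alg (\<lambda>w. \<Sum>a<N. QR_product N ps w $$ (a, a))"
    by (intro in_algebra_sum entry) auto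
  then show ?thesis by (rule in_algebra_eqI) (rule trace_function_conv[OF _ ps])
qed

text \<open>Inside a block g^t meets the transpose of g^-1, and between blocks g^-1 meets g. The
  whole product is thus conjugated by g, and cyclicity of the trace removes g.\<close>

lemma trace_function_invariant:
  assumes g: "g \<in> carrier (GL N)" and w: "w \<in> W_space N d1 d2" and ps: "set ps \<subseteq> {1..d1} \<times> {1..d2}"
  shows "trace_function N ps (GL_act N d1 d2 g w) = trace_function N ps w"
proof -
  let ?h = "inv\<^bsub>GL N\<^esub> g" and ?w = "GL_act N d1 d2 g w"
  note G = GL_inverse[OF g] and W = W_space_entries[OF w]
  have conj: "QR_product N ps ?w = g * QR_product N ps w * ?h" using ps
  proof (induction ps)
    case Nil
    then show ?case using G by simp
  next
    case (Cons p ps)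
    obtain n m where p: "p = (n, m)" "n \<in> {1..d1}" "m \<in> {1..d2}" "set ps \<subseteq> {1..d1} \<times> {1..d2}"
      using Cons.prems by (cases p) auto
    let ?Q = "fst w n" and ?R = "snd w m" and ?P = "QR_product N ps w"
    let ?gt = "transpose_mat g" and ?ht = "transpose_mat ?h"
    have car: "?Q \<in> carrier_mat N N" "?R \<in> carrier_mat N N" "?P \<in> carrier_mat N N"
      "?gt \<in> carrier_mat N N" "?ht \<in> carrier_mat N N" "g \<in> carrier_mat N N" "?h \<in> carrier_mat N N"
      using W QR_product_carrier[OF w] p G by auto
    have t: "?gt * ?ht = 1\<^sub>m N"
      using transpose_mult[OF G(2,1)] G(3) by simp
    have "g * ?Q * ?gt * (?ht * ?R * ?h) = g * (?Q * ((?gt * ?ht) * (?R * ?h)))"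
      using car by (simp add: assoc_mult_mat[of _ N N _ N _ N])
    also have "\<dots> = g * (?Q * (?R * ?h))" using car by (simp add: t)
    finally have QR: "g * ?Q * ?gt * (?ht * ?R * ?h) = g * (?Q * (?R * ?h))" .
    have "QR_product N (p # ps) ?w = g * (?Q * (?R * ?h)) * (g * ?P * ?h)"
      using p Cons.IH by (simp add: GL_act_def QR)
    also have "\<dots> = g * (?Q * (?R * ((?h * g) * (?P * ?h))))"
      using car by (simp add: assoc_mult_mat[of _ N N _ N _ N])
    also have "\<dots> = g * QR_product N (p # ps) w * ?h"
      using car by (simp add: G(3) p(1) assoc_mult_mat[of _ N N _ N _ N])
    finally show ?case .
  qed
  have P: "QR_product N ps w \<in> carrier_mat N N" by (rule QR_product_carrier[OF w ps])
  have "trace_function N ps ?w = (\<Sum>a<N. (g * QR_product N ps w * ?h) $$ (a, a))"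
    using trace_function_conv[OF GL_act_in_W_space[OF g w] ps] by (simp only: conj)
  also have "\<dots> = (\<Sum>a<N. \<Sum>b<N. (g * QR_product N ps w) $$ (a, b) * ?h $$ (b, a))"
    by (intro sum.cong refl mult_mat_entry) (use G P in auto)
  also have "\<dots> = (\<Sum>b<N. \<Sum>a<N. ?h $$ (b, a) * (g * QR_product N ps w) $$ (a, b))"
    by (subst sum.swap) (simp only: mult.commute)
  also have "\<dots> = (\<Sum>b<N. (?h * (g * QR_product N ps w)) $$ (b, b))"
    by (intro sum.cong refl mult_mat_entry[symmetric]) (use G P in auto)
  also have "?h * (g * QR_product N ps w) = QR_product N ps w"
    using G P by (simp add: assoc_mult_mat[of _ N N _ N _ N, symmetric])
  finally show ?thesis using trace_function_conv[OF w ps] by simp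
qed

section \<open>The two inclusions\<close>

lemma trace_algebra_invariant:
  assumes "f \<in> gen_algebra (W_space N d1 d2) (trace_generators N d1 d2)"
  shows "f \<in> invariant_functions N d1 d2"
  using assms
proof induction
  case (const c)
  show ?case unfolding invariant_functions_def
  proof (intro CollectI conjI ballI)
    show "(\<lambda>x\<in>W_space N d1 d2. c) \<in> polynomial_functions N d1 d2"
      unfolding polynomial_functions_def by (rule gen_algebra.const)
  \<comment> \<open>A restricted function is undefined off the space, so invariance requires that
    the action preserve the space.\<close>
  qed (simp add: GL_act_in_W_space)
next
  case (gen f)
  then obtain ps where ps: "f = trace_function N ps" "set ps \<subseteq> {1..d1} \<times> {1..d2}" by blast
  show ?case unfolding invariant_functions_def
  proof (intro CollectI conjI ballI)
    show "restrict f (W_space N d1 d2) \<in> polynomial_functions N d1 d2"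
      using trace_function_polynomial[OF ps(2), of N] unfolding polynomial_functions_def in_algebra_def ps(1) .
  qed (simp add: GL_act_in_W_space trace_function_invariant[OF _ _ ps(2)] ps(1))
next
  case (add f h)
  note IH = add.IH[unfolded invariant_functions_def mem_Collect_eq]
  show ?case unfolding invariant_functions_def
  proof (intro CollectI conjI ballI)
    show "(\<lambda>x\<in>W_space N d1 d2. f x + h x) \<in> polynomial_functions N d1 d2"
      using IH unfolding polynomial_functions_def by (intro gen_algebra.add) simp_all
  qed (use IH in \<open>simp add: GL_act_in_W_space\<close>)
next
  case (mult f h)
  note IH = mult.IH[unfolded invariant_functions_def mem_Collect_eq]
  show ?case unfolding invariant_functions_def
  proof (intro CollectI conjI ballI)
    show "(\<lambda>x\<in>W_space N d1 d2. f x * h x) \<in> polynomial_functions N d1 d2"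
      using IH unfolding polynomial_functions_def by (intro gen_algebra.mult) simp_all
  qed (use IH in \<open>simp add: GL_act_in_W_space\<close>)
qed

lemma invariant_in_trace_algebra:
  fixes f :: "'k::field_char_0 sym_pair \<Rightarrow> 'k"
  assumes "f \<in> invariant_functions N d1 d2"
  shows "f \<in> gen_algebra (W_space N d1 d2) (trace_generators N d1 d2)"
proof -
  have f: "f \<in> polynomial_functions N d1 d2"
    and inv: "\<And>g w. g \<in> carrier (GL N) \<Longrightarrow> w \<in> W_space N d1 d2 \<Longrightarrow> f (GL_act N d1 d2 g w) = f w"
    using assms by (auto simp: invariant_functions_def)
  obtain L where L: "valid_terms N d1 d2 L" "\<And>w. w \<in> W_space N d1 d2 \<Longrightarrow>
      f w = poly_value L (\<lambda>i. Q_entry N d1 d2 i w) (\<lambda>j. R_entry N d1 d2 j w)"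
    using polynomial_function_terms[OF f] by blast
  have "in_algebra (W_space N d1 d2) (trace_generators N d1 d2)
      (\<lambda>w. poly_value L (\<lambda>i. Q_entry N d1 d2 i w) (\<lambda>j. R_entry N d1 d2 j w))"
    by (rule invariant_polynomial_in_algebra[OF L(1) invariant_function_terms[OF L inv]
          Q_entry_symmetric R_entry_symmetric chain_trace_in_algebra])
  then have "in_algebra (W_space N d1 d2) (trace_generators N d1 d2) f"
    using L(2) by (rule in_algebra_eqI)
  \<comment> \<open>Elements of \<open>gen_algebra\<close> are extensional, so restricting
    \<open>f\<close> to the space changes nothing.\<close>
  then show ?thesis
    using gen_algebra_restrict[OF f[unfolded polynomial_functions_def]] by (simp only: in_algebra_def)
qed

theorem mainTheorem4:
  fixes N d1 d2 :: nat
  assumes "d1 \<ge> 1" and "d2 \<ge> 1"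
  shows "(invariant_functions N d1 d2 ::
            ('k::{alg_closed_field, field_char_0} sym_pair \<Rightarrow> 'k) set) =
         gen_algebra (W_space N d1 d2)
           {trace_function N ps | ps. length ps \<ge> 1 \<and> set ps \<subseteq> {1..d1} \<times> {1..d2}}"
  using trace_algebra_invariant invariant_in_trace_algebra by blast

end
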